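(* Let $\Gamma=(V,E)$ be a digraph on $r$ vertices (loops and multiple arcs allowed), let $G$ be a finite group of order $n$, and let $\alpha:E\to G$ be a voltage assignment. Suppose $G$ has $\nu$ conjugacy classes, and let $\rho_1,\ldots,\rho_\nu$ be its irreducible complex representations, of dimensions $d_1,\ldots,d_\nu$ (so $\sum_{i=1}^{\nu} d_i^2=n$). For each $i\in[1,\nu]$, let $\rho_i(B)$ be the $rd_i\times rd_i$ complex matrix obtained from the associated matrix $B$ by replacing each group algebra entry $\sum_{g\in G} a_g g$ by the $d_i\times d_i$ matrix $\sum_{g\in G}a_g\rho_i(g)$. Then the $rn$ eigenvalues of the lift $\Gamma^\alpha$ (i.e. of its adjacency matrix), counted with algebraic multiplicity, are exactly the $rd_i$ eigenvalues of $\rho_i(B)$, for every $i\in[1,\nu]$, each repeated $d_i$ times; that is, as multisets, $\operatorname{spec}\Gamma^\alpha=\biguplus_{i=1}^{\nu} d_i\cdot \operatorname{spec}\rho_i(B)$.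
   Context: For a digraph $\Gamma=(V,E)$, a group $G$ and a map $\alpha:E\to G$ (voltage assignment), the lift $\Gamma^\alpha$ is the digraph with vertex set $V\times G$ and arc set $E\times G$, where the arc $(e,g)$ with $e=uv\in E$ goes from $(u,g)$ to $(v,g\alpha(e))$. Its adjacency matrix $A$ has $(x,y)$-entry equal to the number of arcs from $x$ to $y$; the spectrum of a digraph is the multiset of eigenvalues of its adjacency matrix. The associated matrix $B$ of $(\Gamma,\alpha)$ is the $V\times V$ matrix with entries in the group algebra $\mathbb{C}[G]$ given by $B_{uv}=\sum_{e}\alpha(e)$, the sum over all arcs $e$ from $u$ to $v$ in $\Gamma$ (so $B_{uv}=\sum_{g\in G}a_g g$ where $a_g$ is the number of arcs from $u$ to $v$ with voltage $g$). $[1,m]$ denotes $\{1,\ldots,m\}$. *)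

theory Defs
  imports
    "Graph_Theory.Digraph"
    "HOL-Algebra.Group_Action"
    "Jordan_Normal_Form.Char_Poly"
    "Jordan_Normal_Form.VS_Connect"
begin

section \<open>Spectra\<close>

text \<open>Eigenvalues of a complex square matrix, counted with algebraic multiplicity.\<close>

definition spec :: "complex mat \<Rightarrow> complex multiset" where
  "spec A = proots (char_poly A)"


section \<open>Digraphs, voltage lifts and associated matrices\<close>

definition arcs_from_to :: "('v, 'e) pre_digraph \<Rightarrow> 'v \<Rightarrow> 'v \<Rightarrow> 'e set" where
  "arcs_from_to \<Gamma> u v = {e \<in> arcs \<Gamma>. tail \<Gamma> e = u \<and> head \<Gamma> e = v}"

text \<open>Matrices are indexed by natural numbers, so matrices whose rows and columns are indexed by
  vertices are taken with respect to a list enumerating the vertex set.\<close>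

definition adjacency_mat :: "('v, 'e) pre_digraph \<Rightarrow> 'v list \<Rightarrow> complex mat" where
  "adjacency_mat \<Gamma> vs =
     mat (length vs) (length vs) (\<lambda>(i, j). of_nat (card (arcs_from_to \<Gamma> (vs ! i) (vs ! j))))"

definition lift_digraph ::
  "('v, 'e) pre_digraph \<Rightarrow> ('g, 'm) monoid_scheme \<Rightarrow> ('e \<Rightarrow> 'g) \<Rightarrow> ('v \<times> 'g, 'e \<times> 'g) pre_digraph"
where
  "lift_digraph \<Gamma> G \<alpha> =
     \<lparr>verts = verts \<Gamma> \<times> carrier G,
      arcs = arcs \<Gamma> \<times> carrier G,
      tail = (\<lambda>(e, g). (tail \<Gamma> e, g)),
      head = (\<lambda>(e, g). (head \<Gamma> e, g \<otimes>\<^bsub>G\<^esub> \<alpha> e))\<rparr>"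

text \<open>An element $\sum_g a_g g$ of the group algebra is represented by its coefficient function
  $g \mapsto a_g$; the sum of group elements \<open>\<Sum>e. \<alpha> e\<close> thus becomes a sum of indicators.\<close>

definition associated_mat ::
  "('v, 'e) pre_digraph \<Rightarrow> ('e \<Rightarrow> 'g) \<Rightarrow> 'v list \<Rightarrow> ('g \<Rightarrow> complex) mat" where
  "associated_mat \<Gamma> \<alpha> vs =
     mat (length vs) (length vs)
       (\<lambda>(i, j). \<lambda>g. \<Sum>e\<in>arcs_from_to \<Gamma> (vs ! i) (vs ! j). of_bool (\<alpha> e = g))"


section \<open>Complex matrix representations of a group\<close>

definition GL :: "nat \<Rightarrow> complex mat monoid" where
  "GL d = units_of (ring_mat TYPE(complex) d ())"

definition representation ::
  "('g, 'm) monoid_scheme \<Rightarrow> nat \<Rightarrow> ('g \<Rightarrow> complex mat) \<Rightarrow> bool" where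
  "representation G d \<rho> \<longleftrightarrow> \<rho> \<in> hom G (GL d)"

definition irreducible_rep ::
  "('g, 'm) monoid_scheme \<Rightarrow> nat \<Rightarrow> ('g \<Rightarrow> complex mat) \<Rightarrow> bool" where
  "irreducible_rep G d \<rho> \<longleftrightarrow>
     representation G d \<rho> \<and> d > 0 \<and>
     (\<forall>W. VectorSpace.subspace class_ring W (module_vec TYPE(complex) d) \<longrightarrow>
          (\<forall>g\<in>carrier G. \<forall>w\<in>W. \<rho> g *\<^sub>v w \<in> W) \<longrightarrow>
          W = {0\<^sub>v d} \<or> W = carrier_vec d)"

definition equivalent_reps ::
  "('g, 'm) monoid_scheme \<Rightarrow> nat \<Rightarrow> ('g \<Rightarrow> complex mat) \<Rightarrow> nat \<Rightarrow> ('g \<Rightarrow> complex mat) \<Rightarrow> bool" where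
  "equivalent_reps G d \<rho> d' \<sigma> \<longleftrightarrow>
     d = d' \<and> (\<exists>P\<in>carrier (GL d). \<forall>g\<in>carrier G. P * \<rho> g = \<sigma> g * P)"

text \<open>\<open>\<rho> 1, \<dots>, \<rho> \<nu>\<close>, of dimensions \<open>d 1, \<dots>, d \<nu>\<close>, are the irreducible representations of \<open>G\<close>:
  every irreducible representation occurs in the list exactly once up to equivalence.\<close>

definition irreducible_reps_of ::
  "('g, 'm) monoid_scheme \<Rightarrow> nat \<Rightarrow> (nat \<Rightarrow> nat) \<Rightarrow> (nat \<Rightarrow> 'g \<Rightarrow> complex mat) \<Rightarrow> bool" where
  "irreducible_reps_of G \<nu> d \<rho> \<longleftrightarrow>
     (\<forall>i\<in>{1..\<nu>}. irreducible_rep G (d i) (\<rho> i)) \<and>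
     (\<forall>i\<in>{1..\<nu>}. \<forall>j\<in>{1..\<nu>}. i \<noteq> j \<longrightarrow> \<not> equivalent_reps G (d i) (\<rho> i) (d j) (\<rho> j)) \<and>
     (\<forall>k \<sigma>. irreducible_rep G k \<sigma> \<longrightarrow> (\<exists>i\<in>{1..\<nu>}. equivalent_reps G k \<sigma> (d i) (\<rho> i)))"

definition conjugacy_classes :: "('g, 'm) monoid_scheme \<Rightarrow> 'g set set" where
  "conjugacy_classes G = orbits G (carrier G) (\<lambda>x g. x \<otimes>\<^bsub>G\<^esub> g \<otimes>\<^bsub>G\<^esub> inv\<^bsub>G\<^esub> x)"

text \<open>The matrix $\sum_g a_g \rho(g)$.\<close>

definition group_algebra_rep ::
  "('g, 'm) monoid_scheme \<Rightarrow> nat \<Rightarrow> ('g \<Rightarrow> complex mat) \<Rightarrow> ('g \<Rightarrow> complex) \<Rightarrow> complex mat" where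
  "group_algebra_rep G d \<rho> a = mat d d (\<lambda>(k, l). \<Sum>g\<in>carrier G. a g * \<rho> g $$ (k, l))"

text \<open>Every entry of \<open>B\<close> is replaced by a block of size \<open>d \<times> d\<close>.\<close>

definition rep_mat ::
  "('g, 'm) monoid_scheme \<Rightarrow> nat \<Rightarrow> ('g \<Rightarrow> complex mat) \<Rightarrow> ('g \<Rightarrow> complex) mat \<Rightarrow> complex mat" where
  "rep_mat G d \<rho> B =
     mat (dim_row B * d) (dim_col B * d)
       (\<lambda>(i, j). group_algebra_rep G d \<rho> (B $$ (i div d, j div d)) $$ (i mod d, j mod d))"

end

theory Submission
  imports Defs
begin

text \<open>The matrix coefficients of the irreducible representations form an invertible matrix
  \<open>Q\<close> with rows indexed by \<open>g\<close>, columns by \<open>(i, a, b)\<close> and entries \<open>\<rho> i g $$ (a, b)\<close>, the inverse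
  having the entries \<open>(d i / n) * \<rho> i (inv g) $$ (b, a)\<close>. That this is a left inverse is Schur
  orthogonality. Its kernel is invariant under the regular representation, so if it were nonzero it
  would contain an irreducible constituent; but such a constituent consists of matrix coefficients,
  on which the left inverse is injective. Conjugation with \<open>1 \<otimes> Q\<close>, the identity acting on the
  vertices, turns the adjacency matrix of the lift into a block diagonal matrix in which
  \<open>\<rho> i (B)\<close> occurs once for every \<open>a < d i\<close>.\<close>

section \<open>Injective matrices and subspaces\<close>

text \<open>The multiplicity \<open>d i\<close> comes from multiplicativity: the adjacency matrix
  turns the coefficient function \<open>\<rho> i g $$ (a, b)\<close> of g into a sum of values at
  products g \<otimes> \<alpha> e, and these expand into coefficients at positions (a, c) with the
  same row a. The row is thus an inert label, and each of the \<open>d i\<close> labels carries its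
  own copy of \<open>\<rho> i (B)\<close>. The obstacle is that Q cannot be taken to be square:
  orthogonality alone bounds the number of coefficients by n, and the equality of both numbers,
  which is the identity for the sum of the squares of the \<open>d i\<close>, comes out only once
  the left inverse is known to be injective. This is where the completeness of the list of
  irreducible representations enters, since the constituent of the kernel has to be equivalent to
  one of the \<open>\<rho> i\<close>. Hence the linear algebra below deals with rectangular
  matrices, their injectivity and the resulting bounds on dimensions.\<close>

definition inj_mat :: "complex mat \<Rightarrow> bool" where
  "inj_mat X \<longleftrightarrow> (\<forall>v\<in>carrier_vec (dim_col X). X *\<^sub>v v = 0\<^sub>v (dim_row X) \<longrightarrow> v = 0\<^sub>v (dim_col X))"

lemma inj_matD:
  assumes "inj_mat X" "X \<in> carrier_mat n k" "v \<in> carrier_vec k" "X *\<^sub>v v = 0\<^sub>v n"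
  shows "v = 0\<^sub>v k"
  using assms by (auto simp: inj_mat_def)

text \<open>If \<open>n < k\<close>, padding \<open>X\<close> with zero rows gives a singular square
  matrix, and \<open>X\<close> kills every kernel vector of it.\<close>

lemma inj_mat_dim_le:
  assumes "inj_mat X" "X \<in> carrier_mat n k"
  shows "k \<le> n"
proof (rule ccontr)
  assume "\<not> k \<le> n"
  then have nk: "n < k" by simp
  define M where "M = mat k k (\<lambda>(i, j). if i < n then X $$ (i, j) else 0)"
  have M: "M \<in> carrier_mat k k" by (simp add: M_def)
  \<comment> \<open>The product is row \<open>n\<close> of \<open>M\<close>, the first of the padded
    zero rows.\<close>
  have "transpose_mat M *\<^sub>v unit_vec k n = 0\<^sub>v k"
    using nk by (intro eq_vecI) (auto simp: M_def scalar_prod_def unit_vec_def if_distrib cong: if_cong)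
  moreover have "unit_vec k n \<noteq> (0\<^sub>v k :: complex vec)"
    using nk by (metis index_unit_vec(2) index_zero_vec(1) zero_neq_one)
  ultimately have "det (transpose_mat M) = 0"
    using det_0_iff_vec_prod_zero[of "transpose_mat M" k] M unit_vec_carrier[of k n]
    by (metis transpose_carrier_mat)
  then have "det M = 0" using det_transpose[OF M] by simp
  then obtain v where v: "v \<in> carrier_vec k" "v \<noteq> 0\<^sub>v k" "M *\<^sub>v v = 0\<^sub>v k"
    using det_0_iff_vec_prod_zero[OF M] by blast
  have "X *\<^sub>v v = 0\<^sub>v n"
  proof (rule eq_vecI)
    fix i assume i: "i < dim_vec (0\<^sub>v n :: complex vec)"
    have "(X *\<^sub>v v) $ i = (M *\<^sub>v v) $ i"
      using i nk assms v(1) by (auto simp: M_def scalar_prod_def)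
    then show "(X *\<^sub>v v) $ i = 0\<^sub>v n $ i" using v(3) i nk by simp
  qed (use assms in auto)
  then show False using inj_matD[OF assms v(1)] v(2) by simp
qed

lemma inj_mat_left_inverse:
  assumes "Y * X = 1\<^sub>m k" "X \<in> carrier_mat n k" "Y \<in> carrier_mat k n"
  shows "inj_mat X"
  unfolding inj_mat_def
proof (intro ballI impI)
  fix v assume v: "v \<in> carrier_vec (dim_col X)" "X *\<^sub>v v = 0\<^sub>v (dim_row X)"
  have "v = (Y * X) *\<^sub>v v" using assms v by auto
  also have "\<dots> = Y *\<^sub>v (X *\<^sub>v v)" using assms v by (intro assoc_mult_mat_vec[of _ k n _ k]) auto
  also have "\<dots> = 0\<^sub>v (dim_col X)" using assms v by auto
  finally show "v = 0\<^sub>v (dim_col X)" .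
qed

lemma inverse_mats_same_dim:
  fixes X Y :: "complex mat"
  assumes "X * Y = 1\<^sub>m n" "Y * X = 1\<^sub>m k" "X \<in> carrier_mat n k" "Y \<in> carrier_mat k n"
  shows "n = k"
  using inj_mat_dim_le[OF inj_mat_left_inverse[OF assms(1,4,3)] assms(4)]
    inj_mat_dim_le[OF inj_mat_left_inverse[OF assms(2,3,4)] assms(3)] by simp

lemma mult_mat_unit_vec:
  fixes X :: "complex mat"
  assumes "X \<in> carrier_mat n k" "j < k"
  shows "X *\<^sub>v unit_vec k j = col X j"
  using assms by (intro eq_vecI) (auto simp: scalar_prod_def unit_vec_def if_distrib cong: if_cong)

lemma mat_eq_if_mult_vec_eq:
  fixes X Y :: "complex mat"
  assumes "X \<in> carrier_mat n k" "Y \<in> carrier_mat n k" "\<And>v. v \<in> carrier_vec k \<Longrightarrow> X *\<^sub>v v = Y *\<^sub>v v"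
  shows "X = Y"
proof (rule mat_col_eqI)
  fix j assume "j < dim_col Y"
  then show "col X j = col Y j"
    using assms mult_mat_unit_vec[of X n k j] mult_mat_unit_vec[of Y n k j] by simp
qed (use assms in auto)

text \<open>Preimages of the columns of \<open>Y\<close> are collected as the columns of
  \<open>S\<close>. This converts inclusion of images, a statement about vectors, into a matrix
  equation.\<close>

lemma mat_factor_through:
  fixes X Y :: "complex mat"
  assumes X: "X \<in> carrier_mat n k" and Y: "Y \<in> carrier_mat n l"
    and im: "\<And>v. v \<in> carrier_vec l \<Longrightarrow> \<exists>u\<in>carrier_vec k. Y *\<^sub>v v = X *\<^sub>v u"
  shows "\<exists>S\<in>carrier_mat k l. Y = X * S"
proof -
  have "\<exists>u\<in>carrier_vec k. Y *\<^sub>v unit_vec l j = X *\<^sub>v u" for j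
    by (rule im) simp
  then obtain u where u: "\<And>j. u j \<in> carrier_vec k" "\<And>j. Y *\<^sub>v unit_vec l j = X *\<^sub>v u j" by metis
  define S where "S = mat k l (\<lambda>(i, j). u j $ i)"
  have S: "S \<in> carrier_mat k l" by (simp add: S_def)
  have "Y = X * S"
  proof (rule mat_col_eqI)
    fix j assume "j < dim_col (X * S)"
    then have j: "j < l" using S by simp
    have "col S j = u j" using j u(1)[of j] by (intro eq_vecI) (auto simp: S_def)
    moreover have "col (X * S) j = X *\<^sub>v col S j" using X S j by (auto simp: col_mult2)
    ultimately show "col Y j = col (X * S) j" using u(2)[of j] mult_mat_unit_vec[OF Y j] by simp
  qed (use X Y S in auto)
  then show ?thesis using S by blast
qed

lemma inj_mat_cancel_left:
  assumes "inj_mat X" "X \<in> carrier_mat n k" "A \<in> carrier_mat k l" "B \<in> carrier_mat k l" "X * A = X * B"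
  shows "A = B"
proof (rule mat_eq_if_mult_vec_eq)
  fix v :: "complex vec" assume v: "v \<in> carrier_vec l"
  have "X *\<^sub>v (A *\<^sub>v v - B *\<^sub>v v) = X *\<^sub>v (A *\<^sub>v v) - X *\<^sub>v (B *\<^sub>v v)"
    using assms v by (intro mult_minus_distrib_mat_vec) auto
  also have "\<dots> = (X * A) *\<^sub>v v - (X * B) *\<^sub>v v" using assms(2-4) v by simp
  also have "\<dots> = 0\<^sub>v n"
    unfolding assms(5) using assms(2,4) v by (intro minus_cancel_vec mult_mat_vec_carrier[of _ n l]) auto
  finally have eq: "A *\<^sub>v v - B *\<^sub>v v = 0\<^sub>v k"
    using assms(3,4) v by (intro inj_matD[OF assms(1,2)]) auto
  show "A *\<^sub>v v = B *\<^sub>v v"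
  proof (rule eq_vecI)
    fix i assume "i < dim_vec (B *\<^sub>v v)"
    then show "(A *\<^sub>v v) $ i = (B *\<^sub>v v) $ i"
      using arg_cong[OF eq, of "\<lambda>u. u $ i"] assms(3,4) by simp
  qed (use assms(3,4) in auto)
qed (use assms in auto)

section \<open>Invertible matrices and subspaces of complex vectors\<close>

lemma carrier_GL: "P \<in> carrier (GL d) \<longleftrightarrow>
    P \<in> carrier_mat d d \<and> (\<exists>P'\<in>carrier_mat d d. P' * P = 1\<^sub>m d \<and> P * P' = 1\<^sub>m d)"
  by (auto simp: GL_def units_of_def Units_def ring_mat_simps)

lemma mult_GL: "monoid.mult (GL d) = (*)"
  by (simp add: GL_def units_of_def ring_mat_simps)

lemma one_GL: "monoid.one (GL d) = 1\<^sub>m d"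
  by (simp add: GL_def units_of_def ring_mat_simps)

lemma group_GL: "group (GL d)"
proof -
  interpret ring "ring_mat TYPE(complex) d ()" by (rule ring_mat)
  show ?thesis unfolding GL_def by (rule units_group)
qed

text \<open>Surjectivity yields a right inverse, which is injective because \<open>T\<close> is its
  left inverse. So the dimension bound holds in both directions, and for square matrices a one-sided
  inverse is two-sided.\<close>

lemma bijective_mat_GL:
  assumes T: "T \<in> carrier_mat d e" and inj: "inj_mat T"
    and surj: "\<And>w. w \<in> carrier_vec d \<Longrightarrow> \<exists>v\<in>carrier_vec e. w = T *\<^sub>v v"
  shows "d = e \<and> T \<in> carrier (GL d)"
proof -
  have "\<exists>S\<in>carrier_mat e d. 1\<^sub>m d = T * S"
    by (rule mat_factor_through[OF T]) (use surj in auto)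
  then obtain S where S: "S \<in> carrier_mat e d" "T * S = 1\<^sub>m d" by auto
  have "e \<le> d" "d \<le> e"
    using inj_mat_dim_le[OF inj T] inj_mat_dim_le[OF inj_mat_left_inverse[OF S(2,1) T] S(1)] by auto
  then have de: "d = e" by simp
  moreover have "S * T = 1\<^sub>m d"
    using mat_mult_left_right_inverse[of T d S] S T de by simp
  ultimately show ?thesis using S T by (auto simp: carrier_GL)
qed

text \<open>The closure conditions are stated on vectors directly, so that invariance arguments need
  not handle the module structure inside \<open>irreducible_rep\<close>.\<close>

definition vec_subspace :: "nat \<Rightarrow> complex vec set \<Rightarrow> bool" where
  "vec_subspace d W \<longleftrightarrow> W \<subseteq> carrier_vec d \<and> 0\<^sub>v d \<in> W \<and>
     (\<forall>u\<in>W. \<forall>v\<in>W. u + v \<in> W) \<and> (\<forall>c. \<forall>v\<in>W. c \<cdot>\<^sub>v v \<in> W)"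

lemma subspace_module_vec_iff:
  "VectorSpace.subspace class_ring W (module_vec TYPE(complex) d) \<longleftrightarrow> vec_subspace d W"
proof
  interpret vec_space "TYPE(complex)" d .
  assume "VectorSpace.subspace class_ring W (module_vec TYPE(complex) d)"
  then have "submodule class_ring W V" by (simp add: VectorSpace.subspace_def)
  then show "vec_subspace d W"
    unfolding vec_subspace_def submodule_def by (auto simp: module_vec_simps)
next
  interpret vec_space "TYPE(complex)" d .
  assume "vec_subspace d W"
  then have "submodule class_ring W V"
    unfolding vec_subspace_def submodule_def using module_axioms by (auto simp: module_vec_simps)
  then show "VectorSpace.subspace class_ring W (module_vec TYPE(complex) d)"
    using vectorspace_axioms by (simp add: VectorSpace.subspace_def)
qed

lemma mult_mat_vec_dim_0:
  assumes "(Z :: complex mat) \<in> carrier_mat n 0" "v \<in> carrier_vec 0"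
  shows "Z *\<^sub>v v = 0\<^sub>v n"
  using assms by (intro eq_vecI) (auto simp: scalar_prod_def)

text \<open>The columns of \<open>Z\<close> form a basis of \<open>W\<close>. A maximal number of
  independent columns inside \<open>W\<close> exists by \<open>inj_mat_dim_le\<close>, and a vector
  of \<open>W\<close> outside their span could be appended.\<close>

lemma vec_subspace_frame:
  assumes "vec_subspace k W"
  shows "\<exists>l Z. Z \<in> carrier_mat k l \<and> inj_mat Z \<and> W = (\<lambda>v. Z *\<^sub>v v) ` carrier_vec l"
proof -
  have Wk: "W \<subseteq> carrier_vec k" and W0: "0\<^sub>v k \<in> W" and Wadd: "\<And>u v. u \<in> W \<Longrightarrow> v \<in> W \<Longrightarrow> u + v \<in> W"
    and Wsm: "\<And>c v. v \<in> W \<Longrightarrow> c \<cdot>\<^sub>v v \<in> W"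
    using assms by (auto simp: vec_subspace_def)
  define P where "P l \<longleftrightarrow> (\<exists>Z\<in>carrier_mat k l. inj_mat Z \<and> (\<forall>v\<in>carrier_vec l. Z *\<^sub>v v \<in> W))" for l
  have "P 0"
  proof -
    show ?thesis
      unfolding P_def using W0 mult_mat_vec_dim_0[of "0\<^sub>m k 0" k] by (intro bexI[of _ "0\<^sub>m k 0"]) (auto simp: inj_mat_def)
  qed
  moreover have bd: "P l \<Longrightarrow> l \<le> k" for l
    unfolding P_def using inj_mat_dim_le by blast
  ultimately obtain l where l: "P l" "\<And>m. P m \<Longrightarrow> m \<le> l"
    by (metis GreatestI_nat Greatest_le_nat)
  obtain Z where Z: "Z \<in> carrier_mat k l" "inj_mat Z" "\<And>v. v \<in> carrier_vec l \<Longrightarrow> Z *\<^sub>v v \<in> W"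
    using l(1) by (auto simp: P_def)
  have "w \<in> (\<lambda>v. Z *\<^sub>v v) ` carrier_vec l" if w: "w \<in> W" for w
  proof (rule ccontr)
    assume notin: "w \<notin> (\<lambda>v. Z *\<^sub>v v) ` carrier_vec l"
    have wk: "w \<in> carrier_vec k" using w Wk by auto
    \<comment> \<open>\<open>Z\<close> with \<open>w\<close> appended as last column; its
      injectivity contradicts the maximality of \<open>l\<close>.\<close>
    define Z' where "Z' = mat k (Suc l) (\<lambda>(i, j). if j < l then Z $$ (i, j) else w $ i)"
    have Z': "Z' \<in> carrier_mat k (Suc l)" by (simp add: Z'_def)
    have split: "Z' *\<^sub>v v = Z *\<^sub>v vec l (\<lambda>i. v $ i) + v $ l \<cdot>\<^sub>v w" if "v \<in> carrier_vec (Suc l)" for v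
      using that Z wk by (intro eq_vecI) (auto simp: Z'_def scalar_prod_def)
    have "inj_mat Z'"
      unfolding inj_mat_def
    proof (intro ballI impI)
      fix v assume v: "v \<in> carrier_vec (dim_col Z')" "Z' *\<^sub>v v = 0\<^sub>v (dim_row Z')"
      then have v': "v \<in> carrier_vec (Suc l)" using Z' by simp
      let ?u = "vec l (\<lambda>i. v $ i)"
      have eq: "Z *\<^sub>v ?u + v $ l \<cdot>\<^sub>v w = 0\<^sub>v k" using split[OF v'] v Z' by simp
      \<comment> \<open>Otherwise the relation could be solved for \<open>w\<close>, which would lie
        in the image of \<open>Z\<close>.\<close>
      have vl: "v $ l = 0"
      proof (rule ccontr)
        assume ne: "v $ l \<noteq> 0"
        have "Z *\<^sub>v (- (1 / v $ l) \<cdot>\<^sub>v ?u) = w"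
        proof (rule eq_vecI)
          fix i assume i: "i < dim_vec w"
          have "(Z *\<^sub>v ?u + v $ l \<cdot>\<^sub>v w) $ i = 0" using eq i wk by simp
          then have "(Z *\<^sub>v ?u) $ i + v $ l * w $ i = 0" using i wk Z by simp
          then have "w $ i = - (1 / v $ l) * (Z *\<^sub>v ?u) $ i"
            using ne by (simp add: field_simps add_eq_0_iff)
          then show "(Z *\<^sub>v (- (1 / v $ l) \<cdot>\<^sub>v ?u)) $ i = w $ i"
            using i wk Z by (simp add: mult_mat_vec[OF Z(1)])
        qed (use wk Z in auto)
        then show False using notin by (auto simp: image_def)
      qed
      have "Z *\<^sub>v ?u = 0\<^sub>v k"
      proof -
        have "v $ l \<cdot>\<^sub>v w = 0\<^sub>v k" using vl wk by auto
        then show ?thesis using eq Z by (metis mult_mat_vec_carrier right_zero_vec vec_carrier)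
      qed
      then have "?u = 0\<^sub>v l" using inj_matD[OF Z(2,1)] by simp
      then have "\<And>i. i < l \<Longrightarrow> v $ i = 0" by (metis index_vec index_zero_vec(1))
      then have "\<And>i. i < Suc l \<Longrightarrow> v $ i = 0" using vl less_Suc_eq by auto
      then show "v = 0\<^sub>v (dim_col Z')" using v' Z' by (intro eq_vecI) auto
    qed
    moreover have "\<forall>v\<in>carrier_vec (Suc l). Z' *\<^sub>v v \<in> W"
      using split Z(3) Wadd Wsm w by simp
    ultimately have "P (Suc l)" using Z' by (auto simp: P_def)
    then show False using l(2) by fastforce
  qed
  then show ?thesis using Z by blast
qed

section \<open>Representations and Schur orthogonality\<close>

context
  fixes G :: "('g, 'm) monoid_scheme" and d :: nat and \<rho> :: "'g \<Rightarrow> complex mat"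
  assumes G: "group G" and rep: "representation G d \<rho>"
begin

lemma representation_carrier: "g \<in> carrier G \<Longrightarrow> \<rho> g \<in> carrier_mat d d"
  using rep hom_in_carrier[of \<rho> G "GL d" g] by (auto simp: representation_def carrier_GL)

lemma representation_dims [simp]:
  "g \<in> carrier G \<Longrightarrow> dim_row (\<rho> g) = d" "g \<in> carrier G \<Longrightarrow> dim_col (\<rho> g) = d"
  using representation_carrier by auto

lemma representation_mult:
  "g \<in> carrier G \<Longrightarrow> h \<in> carrier G \<Longrightarrow> \<rho> (g \<otimes>\<^bsub>G\<^esub> h) = \<rho> g * \<rho> h"
  using rep hom_mult[of \<rho> G "GL d" g h] by (simp add: representation_def mult_GL)

lemma representation_one: "\<rho> \<one>\<^bsub>G\<^esub> = 1\<^sub>m d"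
  using hom_one[OF _ G group_GL] rep one_GL by (metis representation_def)

lemma representation_mult_entry:
  assumes "g \<in> carrier G" "h \<in> carrier G" "a < d" "b < d"
  shows "\<rho> (g \<otimes>\<^bsub>G\<^esub> h) $$ (a, b) = (\<Sum>c<d. \<rho> g $$ (a, c) * \<rho> h $$ (c, b))"
  using assms by (simp add: representation_mult scalar_prod_def lessThan_atLeast0)

end

text \<open>Invertibility of the values is automatic: the value at the group inverse is the inverse
  matrix.\<close>

lemma representationI:
  assumes G: "group G" and "\<And>g. g \<in> carrier G \<Longrightarrow> \<rho> g \<in> carrier_mat d d"
    and "\<And>g h. g \<in> carrier G \<Longrightarrow> h \<in> carrier G \<Longrightarrow> \<rho> (g \<otimes>\<^bsub>G\<^esub> h) = \<rho> g * \<rho> h"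
    and "\<rho> \<one>\<^bsub>G\<^esub> = 1\<^sub>m d"
  shows "representation G d \<rho>"
  unfolding representation_def
proof (rule homI)
  interpret group G by fact
  fix g assume g: "g \<in> carrier G"
  have "\<rho> (inv\<^bsub>G\<^esub> g) * \<rho> g = 1\<^sub>m d" "\<rho> g * \<rho> (inv\<^bsub>G\<^esub> g) = 1\<^sub>m d"
    using assms(3)[of "inv\<^bsub>G\<^esub> g" g] assms(3)[of g "inv\<^bsub>G\<^esub> g"] assms(4) g by simp_all
  then show "\<rho> g \<in> carrier (GL d)"
    using assms(2)[OF g] assms(2)[of "inv\<^bsub>G\<^esub> g"] g by (auto simp: carrier_GL)
qed (use assms in \<open>simp add: mult_GL\<close>)

lemma irreducible_rep_iff:
  "irreducible_rep G d \<rho> \<longleftrightarrow> representation G d \<rho> \<and> d > 0 \<and>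
     (\<forall>W. vec_subspace d W \<longrightarrow> (\<forall>g\<in>carrier G. \<forall>w\<in>W. \<rho> g *\<^sub>v w \<in> W) \<longrightarrow>
          W = {0\<^sub>v d} \<or> W = carrier_vec d)"
  by (simp add: irreducible_rep_def subspace_module_vec_iff)

lemma vec_subspace_kernel:
  assumes T: "T \<in> carrier_mat n k"
  shows "vec_subspace k {v \<in> carrier_vec k. T *\<^sub>v v = 0\<^sub>v n}"
  using T by (auto simp: vec_subspace_def mult_add_distrib_mat_vec[OF T] mult_mat_vec[OF T])

lemma vec_subspace_image:
  assumes T: "T \<in> carrier_mat n k"
  shows "vec_subspace n ((\<lambda>v. T *\<^sub>v v) ` carrier_vec k)"
  unfolding vec_subspace_def
proof (intro conjI ballI allI)
  show "0\<^sub>v n \<in> (*\<^sub>v) T ` carrier_vec k"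
    using T by (intro image_eqI[of _ _ "0\<^sub>v k"]) auto
next
  fix u v assume "u \<in> (*\<^sub>v) T ` carrier_vec k" "v \<in> (*\<^sub>v) T ` carrier_vec k"
  then obtain x y where "x \<in> carrier_vec k" "y \<in> carrier_vec k" "u = T *\<^sub>v x" "v = T *\<^sub>v y" by auto
  then show "u + v \<in> (*\<^sub>v) T ` carrier_vec k"
    by (intro image_eqI[of _ _ "x + y"]) (auto simp: mult_add_distrib_mat_vec[OF T])
next
  fix c v assume "v \<in> (*\<^sub>v) T ` carrier_vec k"
  then obtain x where "x \<in> carrier_vec k" "v = T *\<^sub>v x" by auto
  then show "c \<cdot>\<^sub>v v \<in> (*\<^sub>v) T ` carrier_vec k"
    by (intro image_eqI[of _ _ "c \<cdot>\<^sub>v x"]) (auto simp: mult_mat_vec[OF T])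
qed (use T in auto)

text \<open>Kernel and image of an intertwiner are invariant subspaces.\<close>

lemma schur_lemma:
  assumes G: "group G" and \<rho>: "irreducible_rep G d \<rho>" and \<sigma>: "irreducible_rep G e \<sigma>"
    and T: "T \<in> carrier_mat d e" and intw: "\<And>g. g \<in> carrier G \<Longrightarrow> \<rho> g * T = T * \<sigma> g"
    and T0: "T \<noteq> 0\<^sub>m d e"
  shows "inj_mat T" "equivalent_reps G e \<sigma> d \<rho>"
proof -
  have rep: "representation G d \<rho>" "representation G e \<sigma>"
    using \<rho> \<sigma> by (simp_all add: irreducible_rep_iff)
  note car = representation_carrier[OF G rep(1)] representation_carrier[OF G rep(2)]
  have app: "\<rho> g *\<^sub>v (T *\<^sub>v v) = T *\<^sub>v (\<sigma> g *\<^sub>v v)" if "g \<in> carrier G" "v \<in> carrier_vec e" for g v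
    using intw[OF that(1)] car[OF that(1)] that T by (metis assoc_mult_mat_vec)
  have nz: "\<exists>v\<in>carrier_vec e. T *\<^sub>v v \<noteq> 0\<^sub>v d"
  proof (rule ccontr)
    assume "\<not> ?thesis"
    then have "T = 0\<^sub>m d e" by (intro mat_eq_if_mult_vec_eq[OF T]) auto
    then show False using T0 by simp
  qed
  let ?K = "{v \<in> carrier_vec e. T *\<^sub>v v = 0\<^sub>v d}"
  have "\<forall>g\<in>carrier G. \<forall>w\<in>?K. \<sigma> g *\<^sub>v w \<in> ?K"
    using app car by (fastforce simp flip: app)
  then have "?K = {0\<^sub>v e} \<or> ?K = carrier_vec e"
    using \<sigma> vec_subspace_kernel[OF T] unfolding irreducible_rep_iff by blast
  then have "?K = {0\<^sub>v e}" using nz by blast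
  then show inj: "inj_mat T" using T by (auto simp: inj_mat_def)
  let ?I = "(\<lambda>v. T *\<^sub>v v) ` carrier_vec e"
  have "\<forall>g\<in>carrier G. \<forall>w\<in>?I. \<rho> g *\<^sub>v w \<in> ?I"
    using app by (auto intro!: imageI mult_mat_vec_carrier[OF car(2)])
  then have "?I = {0\<^sub>v d} \<or> ?I = carrier_vec d"
    using \<rho> vec_subspace_image[OF T] unfolding irreducible_rep_iff by blast
  then have "?I = carrier_vec d" using nz by blast
  then have "d = e \<and> T \<in> carrier (GL d)"
    by (intro bijective_mat_GL[OF T inj]) auto
  then have de: "d = e" "T \<in> carrier (GL d)" by blast+
  have "\<exists>P\<in>carrier (GL e). \<forall>g\<in>carrier G. P * \<sigma> g = \<rho> g * P"
    by (rule bexI[of _ T]) (simp_all add: intw de(2) flip: de(1))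
  then show "equivalent_reps G e \<sigma> d \<rho>"
    unfolding equivalent_reps_def using de(1) by blast
qed

lemma exists_eigenvalue:
  assumes T: "(T :: complex mat) \<in> carrier_mat d d" and "d > 0"
  shows "\<exists>c. eigenvalue T c"
proof -
  have "degree (char_poly T) = d" using degree_monic_char_poly[OF T] by simp
  then have "\<not> constant (poly (char_poly T))" using assms(2) by (simp add: constant_degree)
  then show ?thesis using fundamental_theorem_of_algebra eigenvalue_root_char_poly[OF T] by blast
qed

text \<open>For an eigenvalue c of \<open>T\<close>, the matrix T - c 1 is again an intertwiner but
  not injective, so Schur's lemma forces it to vanish.\<close>

lemma schur_lemma_scalar:
  assumes G: "group G" and \<rho>: "irreducible_rep G d \<rho>"
    and T: "T \<in> carrier_mat d d" and intw: "\<And>g. g \<in> carrier G \<Longrightarrow> \<rho> g * T = T * \<rho> g"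
  shows "\<exists>c. T = c \<cdot>\<^sub>m 1\<^sub>m d"
proof -
  have rep: "representation G d \<rho>" and "d > 0" using \<rho> by (simp_all add: irreducible_rep_iff)
  obtain c where c: "eigenvalue T c" using exists_eigenvalue[OF T \<open>d > 0\<close>] by blast
  let ?S = "T - c \<cdot>\<^sub>m 1\<^sub>m d"
  have S: "?S \<in> carrier_mat d d" using T by auto
  obtain v where v: "v \<in> carrier_vec d" "v \<noteq> 0\<^sub>v d" "T *\<^sub>v v = c \<cdot>\<^sub>v v"
    using c T by (auto simp: eigenvalue_def eigenvector_def)
  have "?S *\<^sub>v v = T *\<^sub>v v - (c \<cdot>\<^sub>m 1\<^sub>m d) *\<^sub>v v"
    using T v by (intro minus_mult_distrib_mat_vec) auto
  also have "(c \<cdot>\<^sub>m 1\<^sub>m d) *\<^sub>v v = c \<cdot>\<^sub>v v"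
    using v by (intro eq_vecI) (auto simp: scalar_prod_def if_distrib if_distribR sum.delta cong: if_cong)
  finally have "?S *\<^sub>v v = 0\<^sub>v d" using v by auto
  then have "\<not> inj_mat ?S" using inj_matD[OF _ S v(1)] v(2) by blast
  moreover have "\<rho> g * ?S = ?S * \<rho> g" if "g \<in> carrier G" for g
  proof -
    note R = representation_carrier[OF G rep that]
    have "\<rho> g * ?S = \<rho> g * T - \<rho> g * (c \<cdot>\<^sub>m 1\<^sub>m d)" using R T by (intro mult_minus_distrib_mat) auto
    also have "\<rho> g * (c \<cdot>\<^sub>m 1\<^sub>m d) = (c \<cdot>\<^sub>m 1\<^sub>m d) * \<rho> g" using R by auto
    also have "\<rho> g * T - (c \<cdot>\<^sub>m 1\<^sub>m d) * \<rho> g = ?S * \<rho> g"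
      using R T by (simp add: intw[OF that] minus_mult_distrib_mat[of _ d d])
    finally show ?thesis .
  qed
  ultimately have S0: "?S = 0\<^sub>m d d" using schur_lemma(1)[OF G \<rho> \<rho> S] by blast
  have "T $$ (i, j) = (c \<cdot>\<^sub>m 1\<^sub>m d) $$ (i, j)" if "i < d" "j < d" for i j
    using arg_cong[OF S0, of "\<lambda>M. M $$ (i, j)"] that T by simp
  then have "T = c \<cdot>\<^sub>m 1\<^sub>m d" using T by (intro eq_matI) auto
  then show ?thesis by blast
qed

text \<open>\<open>S\<close> is the sum over g of \<rho>(g) E \<sigma>(inv g), where E is the matrix
  unit with its 1 at (b, c). Averaging any matrix in this way produces an intertwiner; matrix units
  are the choice that exposes single coefficients.\<close>

lemma schur_average_intertwines:
  assumes G: "group G" and fin: "finite (carrier G)"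
    and \<rho>: "representation G d \<rho>" and \<sigma>: "representation G e \<sigma>" and bc: "b < d" "c < e"
  defines "S \<equiv> mat d e (\<lambda>(a, f). \<Sum>g\<in>carrier G. \<rho> g $$ (a, b) * \<sigma> (inv\<^bsub>G\<^esub> g) $$ (c, f))"
  assumes h: "h \<in> carrier G"
  shows "\<rho> h * S = S * \<sigma> h"
proof (rule eq_matI)
  interpret group G by fact
  fix a f assume "a < dim_row (S * \<sigma> h)" "f < dim_col (S * \<sigma> h)"
  then have af: "a < d" "f < e"
    using representation_carrier[OF G \<sigma> h] by (auto simp: S_def)
  have shift: "inv\<^bsub>G\<^esub> h \<otimes>\<^bsub>G\<^esub> (h \<otimes>\<^bsub>G\<^esub> g) = g" "h \<otimes>\<^bsub>G\<^esub> (inv\<^bsub>G\<^esub> h \<otimes>\<^bsub>G\<^esub> g) = g"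
    "inv\<^bsub>G\<^esub> (h \<otimes>\<^bsub>G\<^esub> g) \<otimes>\<^bsub>G\<^esub> h = inv\<^bsub>G\<^esub> g" if "g \<in> carrier G" for g
    using h that by (simp_all flip: m_assoc) (simp add: inv_mult_group m_assoc)
  have "(\<rho> h * S) $$ (a, f)
      = (\<Sum>x<d. \<rho> h $$ (a, x) * (\<Sum>g\<in>carrier G. \<rho> g $$ (x, b) * \<sigma> (inv\<^bsub>G\<^esub> g) $$ (c, f)))"
    using af representation_carrier[OF G \<rho> h] by (simp add: S_def scalar_prod_def lessThan_atLeast0)
  also have "\<dots> = (\<Sum>g\<in>carrier G. (\<Sum>x<d. \<rho> h $$ (a, x) * \<rho> g $$ (x, b)) * \<sigma> (inv\<^bsub>G\<^esub> g) $$ (c, f))"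
    unfolding sum_distrib_left sum_distrib_right by (subst sum.swap) (simp add: mult.assoc)
  also have "\<dots> = (\<Sum>g\<in>carrier G. \<rho> (h \<otimes>\<^bsub>G\<^esub> g) $$ (a, b) * \<sigma> (inv\<^bsub>G\<^esub> g) $$ (c, f))"
    using af bc h by (intro sum.cong refl) (simp add: representation_mult_entry[OF G \<rho>])
  \<comment> \<open>The substitution of inv h \<otimes> g for g moves \<open>h\<close> from the left
    factor to the right one.\<close>
  also have "\<dots> = (\<Sum>g\<in>carrier G. \<rho> g $$ (a, b) * \<sigma> (inv\<^bsub>G\<^esub> g \<otimes>\<^bsub>G\<^esub> h) $$ (c, f))"
    using h shift
    by (intro sum.reindex_bij_witness[of _ "\<lambda>g. inv\<^bsub>G\<^esub> h \<otimes>\<^bsub>G\<^esub> g" "\<lambda>g. h \<otimes>\<^bsub>G\<^esub> g"])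
       auto
  also have "\<dots> = (\<Sum>g\<in>carrier G. \<rho> g $$ (a, b) * (\<Sum>x<e. \<sigma> (inv\<^bsub>G\<^esub> g) $$ (c, x) * \<sigma> h $$ (x, f)))"
    using af bc h by (intro sum.cong refl) (simp add: representation_mult_entry[OF G \<sigma>])
  also have "\<dots> = (\<Sum>x<e. (\<Sum>g\<in>carrier G. \<rho> g $$ (a, b) * \<sigma> (inv\<^bsub>G\<^esub> g) $$ (c, x)) * \<sigma> h $$ (x, f))"
    unfolding sum_distrib_left sum_distrib_right by (subst sum.swap) (simp add: mult.assoc)
  also have "\<dots> = (S * \<sigma> h) $$ (a, f)"
    using af representation_carrier[OF G \<sigma> h] by (simp add: S_def scalar_prod_def lessThan_atLeast0)
  finally show "(\<rho> h * S) $$ (a, f) = (S * \<sigma> h) $$ (a, f)" .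
qed (use h representation_carrier[OF G \<sigma> h] representation_carrier[OF G \<rho> h] in \<open>auto simp: S_def\<close>)

text \<open>The sum is an entry of an averaged matrix unit, which intertwines inequivalent
  irreducible representations and is therefore zero.\<close>

lemma schur_orthogonality_inequivalent:
  assumes G: "group G" and fin: "finite (carrier G)"
    and \<rho>: "irreducible_rep G d \<rho>" and \<sigma>: "irreducible_rep G e \<sigma>"
    and neq: "\<not> equivalent_reps G e \<sigma> d \<rho>"
    and bnd: "a < d" "b < d" "c < e" "f < e"
  shows "(\<Sum>g\<in>carrier G. \<rho> g $$ (a, b) * \<sigma> (inv\<^bsub>G\<^esub> g) $$ (c, f)) = 0"
proof -
  have rep: "representation G d \<rho>" "representation G e \<sigma>"
    using \<rho> \<sigma> by (simp_all add: irreducible_rep_iff)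
  let ?S = "mat d e (\<lambda>(a, f). \<Sum>g\<in>carrier G. \<rho> g $$ (a, b) * \<sigma> (inv\<^bsub>G\<^esub> g) $$ (c, f))"
  have "?S = 0\<^sub>m d e"
    using schur_lemma(2)[OF G \<rho> \<sigma>, of ?S] schur_average_intertwines[OF G fin rep bnd(2,3)] neq by auto
  from arg_cong[OF this, of "\<lambda>M. M $$ (a, f)"] show ?thesis using bnd by simp
qed

text \<open>Here the averaged matrix unit is a scalar matrix, and its trace identifies the
  scalar.\<close>

lemma schur_orthogonality_same:
  assumes G: "group G" and fin: "finite (carrier G)" and \<rho>: "irreducible_rep G d \<rho>"
    and bnd: "a < d" "b < d" "c < d" "f < d"
  shows "(\<Sum>g\<in>carrier G. \<rho> g $$ (a, b) * \<rho> (inv\<^bsub>G\<^esub> g) $$ (c, f)) =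
    of_bool (a = f \<and> b = c) * of_nat (card (carrier G)) / of_nat d"
proof -
  interpret group G by fact
  have rep: "representation G d \<rho>" and "d > 0" using \<rho> by (simp_all add: irreducible_rep_iff)
  let ?s = "\<lambda>a f. \<Sum>g\<in>carrier G. \<rho> g $$ (a, b) * \<rho> (inv\<^bsub>G\<^esub> g) $$ (c, f)"
  let ?S = "mat d d (\<lambda>(a, f). ?s a f)"
  obtain k where k: "?S = k \<cdot>\<^sub>m 1\<^sub>m d"
    using schur_lemma_scalar[OF G \<rho>, of ?S] schur_average_intertwines[OF G fin rep rep bnd(2,3)] by auto
  have s: "?s x y = (if x = y then k else 0)" if "x < d" "y < d" for x y
    using arg_cong[OF k, of "\<lambda>M. M $$ (x, y)"] that by simp
  \<comment> \<open>The trace of \<open>?S\<close>. Once the two factors are swapped, the sum over x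
    is an entry of the matrix product for inv g \<otimes> g, that is, of the identity
    matrix.\<close>
  have "of_nat d * k = (\<Sum>x<d. ?s x x)" by (simp add: s)
  also have "\<dots> = (\<Sum>g\<in>carrier G. \<Sum>x<d. \<rho> (inv\<^bsub>G\<^esub> g) $$ (c, x) * \<rho> g $$ (x, b))"
    by (subst sum.swap) (simp add: mult.commute)
  also have "\<dots> = (\<Sum>g\<in>carrier G. \<rho> (inv\<^bsub>G\<^esub> g \<otimes>\<^bsub>G\<^esub> g) $$ (c, b))"
    using bnd by (intro sum.cong refl representation_mult_entry[OF G rep, symmetric]) auto
  also have "\<dots> = of_bool (b = c) * of_nat (card (carrier G))"
    using bnd by (simp add: representation_one[OF G rep])
  finally have "k = of_bool (b = c) * of_nat (card (carrier G)) / of_nat d"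
    using \<open>d > 0\<close> by (simp add: field_simps)
  then show ?thesis using s[OF bnd(1,4)] by simp
qed

text \<open>A frame of minimal positive size with invariant image spans an irreducible constituent,
  so complete reducibility is not needed.\<close>

lemma exists_irreducible_constituent:
  assumes G: "group G" and R: "representation G n R"
    and W: "vec_subspace n W" and Winv: "\<And>g w. g \<in> carrier G \<Longrightarrow> w \<in> W \<Longrightarrow> R g *\<^sub>v w \<in> W"
    and W0: "W \<noteq> {0\<^sub>v n}"
  shows "\<exists>k \<sigma> X. irreducible_rep G k \<sigma> \<and> X \<in> carrier_mat n k \<and> inj_mat X \<and>
    (\<forall>v\<in>carrier_vec k. X *\<^sub>v v \<in> W) \<and> (\<forall>g\<in>carrier G. R g * X = X * \<sigma> g)"
proof -
  interpret group G by fact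
  note Rc = representation_carrier[OF G R]
  define P where "P k \<longleftrightarrow> k > 0 \<and> (\<exists>X\<in>carrier_mat n k. inj_mat X \<and> (\<forall>v\<in>carrier_vec k. X *\<^sub>v v \<in> W) \<and>
    (\<forall>g\<in>carrier G. \<forall>v\<in>carrier_vec k. \<exists>u\<in>carrier_vec k. R g *\<^sub>v (X *\<^sub>v v) = X *\<^sub>v u))" for k
  obtain l Z where Z: "Z \<in> carrier_mat n l" "inj_mat Z" "W = (\<lambda>v. Z *\<^sub>v v) ` carrier_vec l"
    using vec_subspace_frame[OF W] by blast
  have "l > 0"
  proof (rule ccontr)
    assume "\<not> l > 0"
    then have "W \<subseteq> {0\<^sub>v n}" using Z mult_mat_vec_dim_0[of Z n] by auto
    then show False using W W0 by (auto simp: vec_subspace_def)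
  qed
  moreover have "\<exists>u\<in>carrier_vec l. R g *\<^sub>v (Z *\<^sub>v v) = Z *\<^sub>v u" if "g \<in> carrier G" "v \<in> carrier_vec l" for g v
    using Winv[OF that(1), of "Z *\<^sub>v v"] that Z(3) by auto
  ultimately have "P l" using Z by (auto simp: P_def)
  then obtain k where k: "P k" "\<And>m. P m \<Longrightarrow> k \<le> m" by (metis LeastI Least_le)
  then obtain X where "k > 0" and X: "X \<in> carrier_mat n k" "inj_mat X" "\<And>v. v \<in> carrier_vec k \<Longrightarrow> X *\<^sub>v v \<in> W"
    "\<And>g v. g \<in> carrier G \<Longrightarrow> v \<in> carrier_vec k \<Longrightarrow> \<exists>u\<in>carrier_vec k. R g *\<^sub>v (X *\<^sub>v v) = X *\<^sub>v u"
    by (auto simp: P_def)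
  \<comment> \<open>This \<open>S\<close> is the matrix of \<open>R g\<close> restricted to the
    image of \<open>X\<close>, in the basis given by the columns of \<open>X\<close>.\<close>
  have "\<exists>S\<in>carrier_mat k k. R g * X = X * S" if g: "g \<in> carrier G" for g
  proof (rule mat_factor_through[OF X(1)])
    show "R g * X \<in> carrier_mat n k" using Rc[OF g] X(1) by auto
    fix v :: "complex vec" assume "v \<in> carrier_vec k"
    then show "\<exists>u\<in>carrier_vec k. (R g * X) *\<^sub>v v = X *\<^sub>v u"
      using X(4)[OF g] Rc[OF g] X(1) by (metis assoc_mult_mat_vec)
  qed
  then obtain \<sigma> where \<sigma>: "\<And>g. g \<in> carrier G \<Longrightarrow> \<sigma> g \<in> carrier_mat k k"
      "\<And>g. g \<in> carrier G \<Longrightarrow> R g * X = X * \<sigma> g" by metis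
  have rep: "representation G k \<sigma>"
  proof (rule representationI[OF G \<sigma>(1)])
    \<comment> \<open>The homomorphism law of \<open>R\<close> transfers to \<sigma> because the
      injective \<open>X\<close> can be cancelled on the left.\<close>
    fix g h assume gh: "g \<in> carrier G" "h \<in> carrier G"
    have "X * \<sigma> (g \<otimes>\<^bsub>G\<^esub> h) = R g * R h * X"
      using gh by (simp add: representation_mult[OF G R] flip: \<sigma>(2))
    also have "\<dots> = R g * (X * \<sigma> h)"
      unfolding \<sigma>(2)[OF gh(2), symmetric] by (rule assoc_mult_mat[OF Rc[OF gh(1)] Rc[OF gh(2)] X(1)])
    also have "\<dots> = X * \<sigma> g * \<sigma> h"
      unfolding \<sigma>(2)[OF gh(1), symmetric]
      by (rule assoc_mult_mat[OF Rc[OF gh(1)] X(1) \<sigma>(1)[OF gh(2)], symmetric])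
    also have "\<dots> = X * (\<sigma> g * \<sigma> h)"
      by (rule assoc_mult_mat[OF X(1) \<sigma>(1)[OF gh(1)] \<sigma>(1)[OF gh(2)]])
    finally show "\<sigma> (g \<otimes>\<^bsub>G\<^esub> h) = \<sigma> g * \<sigma> h"
      by (intro inj_mat_cancel_left[OF X(2,1) \<sigma>(1) mult_carrier_mat[OF \<sigma>(1) \<sigma>(1)]] m_closed gh)
  next
    have "X * \<sigma> \<one>\<^bsub>G\<^esub> = X * 1\<^sub>m k"
      using X(1) representation_one[OF G R] \<sigma>(2)[OF one_closed] by simp
    then show "\<sigma> \<one>\<^bsub>G\<^esub> = 1\<^sub>m k"
      by (intro inj_mat_cancel_left[OF X(2,1) \<sigma>(1) one_carrier_mat] one_closed)
  qed
  have "U = {0\<^sub>v k} \<or> U = carrier_vec k"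
    if U: "vec_subspace k U" and inv: "\<forall>g\<in>carrier G. \<forall>w\<in>U. \<sigma> g *\<^sub>v w \<in> U" for U
  proof -
    \<comment> \<open>If \<open>Y\<close> is a frame of \<open>U\<close>, then X * Y is a frame of
      an invariant subspace of \<open>W\<close>. Minimality of \<open>k\<close> leaves only m = 0
      and m = k.\<close>
    obtain m Y where Y: "Y \<in> carrier_mat k m" "inj_mat Y" "U = (\<lambda>v. Y *\<^sub>v v) ` carrier_vec m"
      using vec_subspace_frame[OF U] by blast
    have XY: "X * Y \<in> carrier_mat n m" using X Y by auto
    have app: "(X * Y) *\<^sub>v v = X *\<^sub>v (Y *\<^sub>v v)" if "v \<in> carrier_vec m" for v
      using X(1) Y(1) that by simp
    have "inj_mat (X * Y)"
      unfolding inj_mat_def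
    proof (intro ballI impI)
      fix v assume v: "v \<in> carrier_vec (dim_col (X * Y))" "(X * Y) *\<^sub>v v = 0\<^sub>v (dim_row (X * Y))"
      then have v': "v \<in> carrier_vec m" "X *\<^sub>v (Y *\<^sub>v v) = 0\<^sub>v n" using app X(1) Y(1) by auto
      then have "Y *\<^sub>v v = 0\<^sub>v k" using Y(1) by (intro inj_matD[OF X(2,1)]) auto
      then show "v = 0\<^sub>v (dim_col (X * Y))" using inj_matD[OF Y(2,1) v'(1)] Y(1) by simp
    qed
    moreover have "\<forall>v\<in>carrier_vec m. (X * Y) *\<^sub>v v \<in> W" using app X(3) Y(1) by simp
    moreover have "\<exists>u\<in>carrier_vec m. R g *\<^sub>v ((X * Y) *\<^sub>v v) = (X * Y) *\<^sub>v u"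
      if gv: "g \<in> carrier G" "v \<in> carrier_vec m" for g v
    proof -
      have Yv: "Y *\<^sub>v v \<in> carrier_vec k" "Y *\<^sub>v v \<in> U" using Y gv by auto
      then obtain u where u: "u \<in> carrier_vec m" "\<sigma> g *\<^sub>v (Y *\<^sub>v v) = Y *\<^sub>v u"
        using inv gv(1) Y(3) by blast
      have "R g *\<^sub>v (X *\<^sub>v (Y *\<^sub>v v)) = (R g * X) *\<^sub>v (Y *\<^sub>v v)" using Rc[OF gv(1)] X(1) Yv by simp
      also have "\<dots> = X *\<^sub>v (\<sigma> g *\<^sub>v (Y *\<^sub>v v))"
        using \<sigma>[OF gv(1)] X(1) Yv by (simp add: assoc_mult_mat_vec[of _ n k _ k])
      finally show ?thesis using app u gv(2) by auto
    qed
    ultimately have "m > 0 \<Longrightarrow> P m" using XY by (auto simp: P_def)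
    then have "m = 0 \<or> k \<le> m" using k(2) by blast
    then consider "m = 0" | "k = m" using inj_mat_dim_le[OF Y(2,1)] by linarith
    then show ?thesis
    proof cases
      case 1
      then have "U \<subseteq> {0\<^sub>v k}" using Y mult_mat_vec_dim_0[of Y k] by auto
      then show ?thesis using U by (auto simp: vec_subspace_def)
    next
      case 2
      \<comment> \<open>An injective square matrix is invertible, so its image \<open>U\<close> is
        the whole space.\<close>
      have "det Y \<noteq> 0"
        using det_0_iff_vec_prod_zero[of Y k] Y(1) 2 inj_matD[OF Y(2,1)] by auto
      then obtain Y' where Y': "Y' \<in> carrier_mat k k" "Y * Y' = 1\<^sub>m k"
        using det_non_zero_imp_unit[of Y k] Y(1) 2 by (auto simp: Units_def ring_mat_simps)
      have "w = Y *\<^sub>v (Y' *\<^sub>v w)" if "w \<in> carrier_vec k" for w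
        using that Y' Y(1) 2 by (metis assoc_mult_mat_vec one_mult_mat_vec)
      then have "carrier_vec k \<subseteq> U" using Y(3) Y'(1) 2 by (metis imageI mult_mat_vec_carrier subsetI)
      then show ?thesis using U by (auto simp: vec_subspace_def)
    qed
  qed
  then have "irreducible_rep G k \<sigma>" using rep \<open>k > 0\<close> by (simp add: irreducible_rep_iff)
  then show ?thesis using X \<sigma> by blast
qed

section \<open>Matrices indexed by lists\<close>

text \<open>Rows and columns are addressed by elements of arbitrary types. For distinct lists,
  products become sums over sets, so that matrix identities reduce to identities of functions in
  which positions no longer occur.\<close>

definition indexed_mat :: "'a list \<Rightarrow> 'b list \<Rightarrow> ('a \<Rightarrow> 'b \<Rightarrow> complex) \<Rightarrow> complex mat" where
  "indexed_mat xs ys F = mat (length xs) (length ys) (\<lambda>(i, j). F (xs ! i) (ys ! j))"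

lemma indexed_mat_carrier [simp]: "indexed_mat xs ys F \<in> carrier_mat (length xs) (length ys)"
  by (simp add: indexed_mat_def)

lemma indexed_mat_dims [simp]:
  "dim_row (indexed_mat xs ys F) = length xs" "dim_col (indexed_mat xs ys F) = length ys"
  by (simp_all add: indexed_mat_def)

lemma indexed_mat_eq_iff:
  "indexed_mat xs ys F = indexed_mat xs ys H \<longleftrightarrow> (\<forall>x\<in>set xs. \<forall>y\<in>set ys. F x y = H x y)"
proof
  assume eq: "indexed_mat xs ys F = indexed_mat xs ys H"
  show "\<forall>x\<in>set xs. \<forall>y\<in>set ys. F x y = H x y"
  proof (intro ballI)
    fix x y assume "x \<in> set xs" "y \<in> set ys"
    then obtain i j where "i < length xs" "x = xs ! i" "j < length ys" "y = ys ! j"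
      by (metis in_set_conv_nth)
    then show "F x y = H x y"
      using arg_cong[OF eq, of "\<lambda>M. M $$ (i, j)"] by (simp add: indexed_mat_def)
  qed
qed (auto simp: indexed_mat_def intro!: eq_matI)

lemma sum_nth_distinct:
  fixes f :: "'a \<Rightarrow> complex"
  shows "distinct ys \<Longrightarrow> (\<Sum>i = 0..<length ys. f (ys ! i)) = sum f (set ys)"
  using sum.reindex_bij_betw[OF bij_betw_nth[of ys "{0..<length ys}" "set ys"], of f]
  by (simp add: lessThan_atLeast0)

lemma indexed_mat_mult:
  assumes "distinct ys"
  shows "indexed_mat xs ys F * indexed_mat ys zs H = indexed_mat xs zs (\<lambda>x z. \<Sum>y\<in>set ys. F x y * H y z)"
proof (rule eq_matI)
  fix i j assume "i < dim_row (indexed_mat xs zs (\<lambda>x z. \<Sum>y\<in>set ys. F x y * H y z))"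
    "j < dim_col (indexed_mat xs zs (\<lambda>x z. \<Sum>y\<in>set ys. F x y * H y z))"
  then show "(indexed_mat xs ys F * indexed_mat ys zs H) $$ (i, j) =
      indexed_mat xs zs (\<lambda>x z. \<Sum>y\<in>set ys. F x y * H y z) $$ (i, j)"
    using sum_nth_distinct[OF assms, of "\<lambda>y. F (xs ! i) y * H y (zs ! j)"]
    by (simp add: indexed_mat_def scalar_prod_def)
qed auto

lemma indexed_mat_one:
  assumes "distinct xs"
  shows "indexed_mat xs xs (\<lambda>x y. of_bool (x = y)) = 1\<^sub>m (length xs)"
  using assms by (intro eq_matI) (auto simp: indexed_mat_def nth_eq_iff_index_eq)

text \<open>Distinctness allows a position to be recovered from the element found there.\<close>

lemma mat_as_indexed_mat:
  assumes "distinct xs" "distinct ys" "M \<in> carrier_mat (length xs) (length ys)"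
  obtains F where "M = indexed_mat xs ys F"
proof -
  have ix: "the_inv_into {..<length zs} ((!) zs) (zs ! i) = i"
    if "distinct zs" "i < length zs" for zs :: "'c list" and i
    using that by (intro the_inv_into_f_f) (auto simp: inj_on_nth)
  have "M = indexed_mat xs ys (\<lambda>x y. M $$ (the_inv_into {..<length xs} ((!) xs) x,
      the_inv_into {..<length ys} ((!) ys) y))"
    using assms by (intro eq_matI) (auto simp: indexed_mat_def ix)
  then show thesis by (rule that)
qed

text \<open>Change of basis between index sets of different types: A P = P D with \<open>P\<close>
  invertible. Equality of the two lengths is a conclusion, forced by the two-sided inverse.\<close>

lemma indexed_mat_similar:
  assumes xs: "distinct xs" and ys: "distinct ys"
    and PP': "\<And>x z. x \<in> set xs \<Longrightarrow> z \<in> set xs \<Longrightarrow> (\<Sum>y\<in>set ys. P x y * P' y z) = of_bool (x = z)"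
    and P'P: "\<And>y w. y \<in> set ys \<Longrightarrow> w \<in> set ys \<Longrightarrow> (\<Sum>x\<in>set xs. P' y x * P x w) = of_bool (y = w)"
    and AP: "\<And>x y. x \<in> set xs \<Longrightarrow> y \<in> set ys \<Longrightarrow>
      (\<Sum>z\<in>set xs. A x z * P z y) = (\<Sum>w\<in>set ys. P x w * D w y)"
  shows "length xs = length ys" "char_poly (indexed_mat xs xs A) = char_poly (indexed_mat ys ys D)"
proof -
  let ?P = "indexed_mat xs ys P" and ?P' = "indexed_mat ys xs P'"
  let ?A = "indexed_mat xs xs A" and ?D = "indexed_mat ys ys D"
  have 1: "?P * ?P' = 1\<^sub>m (length xs)"
    unfolding indexed_mat_mult[OF ys] indexed_mat_one[OF xs, symmetric] indexed_mat_eq_iff using PP' by auto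
  have 2: "?P' * ?P = 1\<^sub>m (length ys)"
    unfolding indexed_mat_mult[OF xs] indexed_mat_one[OF ys, symmetric] indexed_mat_eq_iff using P'P by auto
  have 3: "?A * ?P = ?P * ?D"
    unfolding indexed_mat_mult[OF xs] indexed_mat_mult[OF ys] indexed_mat_eq_iff using AP by auto
  show len: "length xs = length ys"
    by (rule inverse_mats_same_dim[OF 1 2]) auto
  have "?A = ?A * (?P * ?P')" unfolding 1 by (metis indexed_mat_carrier right_mult_one_mat)
  also have "\<dots> = ?A * ?P * ?P'"
    by (rule assoc_mult_mat[symmetric]) (rule indexed_mat_carrier)+
  finally have "?A = ?P * ?D * ?P'" unfolding 3 .
  then have "similar_mat ?A ?D"
    using 1 2 len by (intro similar_matI[of _ _ ?P ?P' "length xs"]) (auto simp: indexed_mat_def)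
  then show "char_poly ?A = char_poly ?D" by (rule char_poly_similar)
qed

section \<open>Characteristic polynomials of block diagonal matrices\<close>

lemma char_poly_four_block_diag:
  assumes A: "(A :: complex mat) \<in> carrier_mat n n" and B: "B \<in> carrier_mat m m"
  shows "char_poly (four_block_mat A (0\<^sub>m n m) (0\<^sub>m m n) B) = char_poly A * char_poly B"
proof -
  \<comment> \<open>The characteristic matrix x 1 - A; it inherits the block form, so the
    determinant factors.\<close>
  let ?cm = "\<lambda>A. [:0, 1:] \<cdot>\<^sub>m 1\<^sub>m (dim_row A) + map_mat (\<lambda>a. [:- a:]) A"
  have "?cm (four_block_mat A (0\<^sub>m n m) (0\<^sub>m m n) B)
      = four_block_mat (?cm A) (0\<^sub>m n m) (0\<^sub>m m n) (?cm B)"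
    using A B by (intro eq_matI) (auto simp: one_poly_def)
  then show ?thesis
    unfolding char_poly_defs
    using A B det_four_block_mat_lower_left_zero[of "?cm A" n "0\<^sub>m n m" m "0\<^sub>m m n" "?cm B"] by auto
qed

lemma char_poly_indexed_mat_append:
  assumes "\<And>x y. x \<in> set xs \<Longrightarrow> y \<in> set ys \<Longrightarrow> H x y = 0 \<and> H y x = 0"
  shows "char_poly (indexed_mat (xs @ ys) (xs @ ys) H)
    = char_poly (indexed_mat xs xs H) * char_poly (indexed_mat ys ys H)"
proof -
  have "indexed_mat (xs @ ys) (xs @ ys) H = four_block_mat (indexed_mat xs xs H)
      (0\<^sub>m (length xs) (length ys)) (0\<^sub>m (length ys) (length xs)) (indexed_mat ys ys H)"
    using assms by (intro eq_matI) (auto simp: indexed_mat_def nth_append)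
  then show ?thesis by (simp add: char_poly_four_block_diag)
qed

lemma char_poly_indexed_mat_concat:
  assumes "distinct bs"
    and "\<And>b c x y. b \<in> set bs \<Longrightarrow> c \<in> set bs \<Longrightarrow> b \<noteq> c \<Longrightarrow> x \<in> set (f b) \<Longrightarrow> y \<in> set (f c) \<Longrightarrow> H x y = 0"
  shows "char_poly (indexed_mat (concat (map f bs)) (concat (map f bs)) H)
    = (\<Prod>b\<in>set bs. char_poly (indexed_mat (f b) (f b) H))"
  using assms
proof (induction bs)
  case Nil
  have "char_poly (indexed_mat [] [] H) = 1" by (simp add: char_poly_defs indexed_mat_def)
  then show ?case by simp
next
  case (Cons b bs)
  have "char_poly (indexed_mat (f b @ concat (map f bs)) (f b @ concat (map f bs)) H)
    = char_poly (indexed_mat (f b) (f b) H) * char_poly (indexed_mat (concat (map f bs)) (concat (map f bs)) H)"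
  proof (rule char_poly_indexed_mat_append)
    fix x y assume xy: "x \<in> set (f b)" "y \<in> set (concat (map f bs))"
    then obtain c where c: "c \<in> set bs" "y \<in> set (f c)" by auto
    then have "b \<noteq> c" using Cons.prems(1) by auto
    then show "H x y = 0 \<and> H y x = 0"
      using Cons.prems(2)[of b c x y] Cons.prems(2)[of c b y x] xy(1) c by simp
  qed
  also have "char_poly (indexed_mat (concat (map f bs)) (concat (map f bs)) H)
    = (\<Prod>b\<in>set bs. char_poly (indexed_mat (f b) (f b) H))"
  proof (rule Cons.IH)
    show "distinct bs" using Cons.prems(1) by simp
  qed (rule Cons.prems(2), simp_all)
  finally show ?case using Cons.prems(1) by simp
qed

section \<open>Completeness of matrix coefficients\<close>

locale finite_group_irreps = group G for G (structure) +
  fixes \<nu> :: nat and d :: "nat \<Rightarrow> nat" and \<rho> :: "nat \<Rightarrow> 'a \<Rightarrow> complex mat"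
  assumes fin: "finite (carrier G)" and irreps: "irreducible_reps_of G \<nu> d \<rho>"
begin

lemma irrep: "i \<in> {1..\<nu>} \<Longrightarrow> irreducible_rep G (d i) (\<rho> i)"
  using irreps by (simp add: irreducible_reps_of_def)

lemma rep: "i \<in> {1..\<nu>} \<Longrightarrow> representation G (d i) (\<rho> i)"
  using irrep by (simp add: irreducible_rep_iff)

lemma dim_pos: "i \<in> {1..\<nu>} \<Longrightarrow> d i > 0"
  using irrep by (simp add: irreducible_rep_iff)

definition coef_index :: "(nat \<times> nat \<times> nat) set" where
  "coef_index = (SIGMA i:{1..\<nu>}. {..<d i} \<times> {..<d i})"

definition coef :: "'a \<Rightarrow> nat \<times> nat \<times> nat \<Rightarrow> complex" where
  "coef g = (\<lambda>(i, a, b). \<rho> i g $$ (a, b))"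

text \<open>The factor is the reciprocal of the constant n / d i in
  \<open>schur_orthogonality_same\<close>; the positions \<open>a\<close> and \<open>b\<close> are
  swapped because orthogonality pairs an entry with the transposed entry at the inverse
  element.\<close>

definition dual_coef :: "nat \<times> nat \<times> nat \<Rightarrow> 'a \<Rightarrow> complex" where
  "dual_coef = (\<lambda>(i, a, b) g. of_nat (d i) / of_nat (card (carrier G)) * \<rho> i (inv g) $$ (b, a))"

lemma finite_coef_index: "finite coef_index"
  by (simp add: coef_index_def)

lemma card_pos: "card (carrier G) > 0"
  using fin one_closed by (auto simp: card_gt_0_iff)

lemma coef_orthogonal:
  assumes "x \<in> coef_index" "y \<in> coef_index"
  shows "(\<Sum>g\<in>carrier G. dual_coef x g * coef g y) = of_bool (x = y)"
proof -
  obtain i a b where x: "x = (i, a, b)" by (cases x)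
  obtain j a' b' where y: "y = (j, a', b')" by (cases y)
  have i: "i \<in> {1..\<nu>}" "a < d i" "b < d i" and j: "j \<in> {1..\<nu>}" "a' < d j" "b' < d j"
    using assms by (auto simp: x y coef_index_def)
  have eq: "(\<Sum>g\<in>carrier G. dual_coef x g * coef g y) = of_nat (d i) / of_nat (card (carrier G)) *
      (\<Sum>g\<in>carrier G. \<rho> j g $$ (a', b') * \<rho> i (inv g) $$ (b, a))"
    by (simp add: x y dual_coef_def coef_def sum_distrib_left mult_ac)
  show ?thesis
  proof (cases "i = j")
    case True
    then show ?thesis
      unfolding eq using schur_orthogonality_same[OF is_group fin irrep[OF i(1)], of a' b' b a] i j
        card_pos dim_pos[OF i(1)] by (auto simp: x y)
  next
    case False
    then have "\<not> equivalent_reps G (d i) (\<rho> i) (d j) (\<rho> j)"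
      using irreps i(1) j(1) by (simp add: irreducible_reps_of_def)
    then show ?thesis
      unfolding eq using False
        schur_orthogonality_inequivalent[OF is_group fin irrep[OF j(1)] irrep[OF i(1)], of a' b' b a] i j
      by (simp add: x y)
  qed
qed

text \<open>Matrix multiplication of coefficients affects only the column position. The lemma
  inserts such a sum over one row (i, a) into a sum over all of \<open>coef_index\<close>.\<close>

lemma sum_coef_row:
  assumes "i \<in> {1..\<nu>}" "a < d i"
  shows "(\<Sum>y\<in>coef_index. case y of (j, a', c) \<Rightarrow> of_bool (i = j \<and> a = a') * f j a' c) = (\<Sum>c<d i. f i a c :: complex)"
proof -
  have "(\<Sum>c<d i. f i a c) = (\<Sum>y\<in>(\<lambda>c. (i, a, c)) ` {..<d i}. case y of (j, a', c) \<Rightarrow> of_bool (i = j \<and> a = a') * f j a' c)"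
    by (subst sum.reindex) (auto simp: inj_on_def)
  also have "\<dots> = (\<Sum>y\<in>coef_index. case y of (j, a', c) \<Rightarrow> of_bool (i = j \<and> a = a') * f j a' c)"
    using assms by (intro sum.mono_neutral_left finite_coef_index) (auto simp: coef_index_def)
  finally show ?thesis ..
qed

text \<open>Since \<sigma> is conjugate to some \<open>\<rho> i\<close>, its entries are fixed
  linear combinations of those of \<open>\<rho> i\<close>; the weights are products of entries of
  the conjugating matrix and its inverse, independent of the group element.\<close>

lemma equivalent_rep_coefs:
  assumes \<sigma>: "irreducible_rep G k \<sigma>"
  obtains i z where "i \<in> {1..\<nu>}" "\<And>h c b. h \<in> carrier G \<Longrightarrow> c < k \<Longrightarrow> b < k \<Longrightarrow>
    \<sigma> h $$ (c, b) = (\<Sum>a<d i. \<Sum>e<d i. z c a e b * \<rho> i h $$ (a, e))"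
proof -
  obtain i P where i: "i \<in> {1..\<nu>}" "k = d i" and P: "P \<in> carrier (GL k)"
    and PR: "\<And>g. g \<in> carrier G \<Longrightarrow> P * \<sigma> g = \<rho> i g * P"
    using irreps \<sigma> unfolding irreducible_reps_of_def equivalent_reps_def by metis
  obtain P' where P': "P' \<in> carrier_mat k k" "P' * P = 1\<^sub>m k" and Pc: "P \<in> carrier_mat k k"
    using P by (auto simp: carrier_GL)
  have "\<sigma> h $$ (c, b) = (\<Sum>a<d i. \<Sum>e<d i. P' $$ (c, a) * P $$ (e, b) * \<rho> i h $$ (a, e))"
    if h: "h \<in> carrier G" and cb: "c < k" "b < k" for h c b
  proof -
    have s: "\<sigma> h \<in> carrier_mat k k" and r: "\<rho> i h \<in> carrier_mat k k"
      using representation_carrier[OF is_group _ h] \<sigma> rep[OF i(1)] i(2) by (auto simp: irreducible_rep_iff)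
    have "\<sigma> h = P' * P * \<sigma> h" using P' s by simp
    also have "\<dots> = P' * (\<rho> i h * P)" using assoc_mult_mat[OF P'(1) Pc s] PR[OF h] by simp
    finally have "\<sigma> h $$ (c, b) = (P' * (\<rho> i h * P)) $$ (c, b)" by simp
    also have "\<dots> = (\<Sum>a<d i. \<Sum>e<d i. P' $$ (c, a) * P $$ (e, b) * \<rho> i h $$ (a, e))"
      using P'(1) Pc r cb i(2)
      by (simp add: scalar_prod_def lessThan_atLeast0 sum_distrib_left mult_ac)
    finally show ?thesis .
  qed
  then show thesis using that[OF i(1), of "\<lambda>c a e b. P' $$ (c, a) * P $$ (e, b)"] by blast
qed

text \<open>The matrix for \<open>k\<close> acts on functions on the group by right translation,
  taking v to the function with value v(g \<otimes> k) at g. Right translation suits the lift, whose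
  arcs multiply by voltages on the right.\<close>

lemma regular_representation:
  assumes gs: "distinct gs" "set gs = carrier G"
  shows "representation G (length gs) (\<lambda>k. indexed_mat gs gs (\<lambda>g h. of_bool (h = g \<otimes> k)))"
proof (rule representationI[OF is_group])
  fix k l assume kl: "k \<in> carrier G" "l \<in> carrier G"
  show "indexed_mat gs gs (\<lambda>g h. of_bool (h = g \<otimes> (k \<otimes> l))) =
      indexed_mat gs gs (\<lambda>g h. of_bool (h = g \<otimes> k)) * indexed_mat gs gs (\<lambda>g h. of_bool (h = g \<otimes> l))"
    unfolding indexed_mat_mult[OF gs(1)] indexed_mat_eq_iff gs(2)
  proof (intro ballI)
    fix g h assume g: "g \<in> carrier G"
    have "(\<Sum>m\<in>carrier G. of_bool (m = g \<otimes> k) * of_bool (h = m \<otimes> l) :: complex)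
        = (\<Sum>m\<in>carrier G. if m = g \<otimes> k then of_bool (h = g \<otimes> k \<otimes> l) else 0)"
      by (intro sum.cong refl) auto
    also have "\<dots> = of_bool (h = g \<otimes> (k \<otimes> l))" using kl g fin by (simp add: m_assoc)
    finally show "of_bool (h = g \<otimes> (k \<otimes> l)) = (\<Sum>m\<in>carrier G. of_bool (m = g \<otimes> k) * of_bool (h = m \<otimes> l) :: complex)"
      by simp
  qed
next
  have "indexed_mat gs gs (\<lambda>g h. of_bool (h = g \<otimes> \<one>)) = indexed_mat gs gs (\<lambda>g h. of_bool (g = h))"
    unfolding indexed_mat_eq_iff gs(2) by auto
  then show "indexed_mat gs gs (\<lambda>g h. of_bool (h = g \<otimes> \<one>)) = 1\<^sub>m (length gs)"
    by (simp add: indexed_mat_one[OF gs(1)])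
qed simp

text \<open>A constituent \<open>X\<close> of the common kernel of the dual coefficients consists of matrix
  coefficients of an irreducible representation, and these are recovered by the dual
  coefficients.\<close>

lemma dual_coef_inj:
  assumes gs: "distinct gs" "set gs = carrier G" and js: "distinct js" "set js = coef_index"
  shows "inj_mat (indexed_mat js gs dual_coef)"
proof -
  let ?n = "length gs"
  let ?Q' = "indexed_mat js gs dual_coef"
  let ?R = "\<lambda>k. indexed_mat gs gs (\<lambda>g h. of_bool (h = g \<otimes> k))"
  let ?W = "{v \<in> carrier_vec ?n. ?Q' *\<^sub>v v = 0\<^sub>v (length js)}"
  \<comment> \<open>Right translation seen through the dual coefficients: \<open>\<rho> i k\<close>
    acts on the last position only. The relation \<open>QR\<close> below makes the kernel of
    \<open>?Q'\<close> invariant.\<close>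
  let ?D = "\<lambda>k. indexed_mat js js (\<lambda>(i, a, b) (j, a', c). of_bool (i = j \<and> a = a') * \<rho> i k $$ (b, c))"
  have R: "representation G ?n ?R" by (rule regular_representation[OF gs])
  have QR: "?Q' * ?R k = ?D k * ?Q'" if k: "k \<in> carrier G" for k
    unfolding indexed_mat_mult[OF gs(1)] indexed_mat_mult[OF js(1)] indexed_mat_eq_iff gs(2) js(2)
  proof (intro ballI)
    fix x h assume x: "x \<in> coef_index" and h: "h \<in> carrier G"
    obtain i a b where xe: "x = (i, a, b)" by (cases x)
    have i: "i \<in> {1..\<nu>}" "a < d i" "b < d i" using x by (auto simp: xe coef_index_def)
    have "(\<Sum>g\<in>carrier G. dual_coef x g * of_bool (h = g \<otimes> k)) = (\<Sum>g\<in>carrier G. if g = h \<otimes> inv k then dual_coef x g else 0)"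
      using h k by (intro sum.cong refl) (auto simp: inv_solve_right m_assoc)
    also have "\<dots> = dual_coef x (h \<otimes> inv k)" using fin h k by simp
    also have "\<dots> = of_nat (d i) / of_nat (card (carrier G)) * \<rho> i (k \<otimes> inv h) $$ (b, a)"
      using h k by (simp add: xe dual_coef_def inv_mult_group)
    also have "\<dots> = (\<Sum>c<d i. \<rho> i k $$ (b, c) * (of_nat (d i) / of_nat (card (carrier G)) * \<rho> i (inv h) $$ (c, a)))"
      using h k i by (simp add: representation_mult_entry[OF is_group rep] sum_distrib_left mult_ac)
    also have "\<dots> = (\<Sum>y\<in>coef_index. case y of (j, a', c) \<Rightarrow> of_bool (i = j \<and> a = a') *
        (\<rho> i k $$ (b, c) * dual_coef (j, a', c) h))"
      by (subst sum_coef_row[OF i(1,2)]) (simp add: dual_coef_def)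
    also have "\<dots> = (\<Sum>y\<in>coef_index. (case x of (i, a, b) \<Rightarrow> \<lambda>(j, a', c). of_bool (i = j \<and> a = a') * \<rho> i k $$ (b, c)) y
        * dual_coef y h)"
      by (intro sum.cong refl) (auto simp: xe)
    finally show "(\<Sum>g\<in>carrier G. dual_coef x g * of_bool (h = g \<otimes> k)) = \<dots>" .
  qed
  have "?W = {0\<^sub>v ?n}"
  proof (rule ccontr)
    assume ne: "?W \<noteq> {0\<^sub>v ?n}"
    have inv: "?R g *\<^sub>v w \<in> ?W" if g: "g \<in> carrier G" and w: "w \<in> ?W" for g w
    proof -
      have "?Q' *\<^sub>v (?R g *\<^sub>v w) = (?Q' * ?R g) *\<^sub>v w"
        using w by (intro assoc_mult_mat_vec[symmetric] indexed_mat_carrier) auto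
      also have "\<dots> = ?D g *\<^sub>v (?Q' *\<^sub>v w)"
        unfolding QR[OF g] using w by (intro assoc_mult_mat_vec indexed_mat_carrier) auto
      also have "\<dots> = 0\<^sub>v (length js)" using w by (auto intro!: eq_vecI)
      finally show ?thesis using w by (auto intro!: mult_mat_vec_carrier[OF indexed_mat_carrier])
    qed
    obtain k \<sigma> X where \<sigma>: "irreducible_rep G k \<sigma>" and X: "X \<in> carrier_mat ?n k" "inj_mat X"
      "\<And>v. v \<in> carrier_vec k \<Longrightarrow> X *\<^sub>v v \<in> ?W" "\<And>g. g \<in> carrier G \<Longrightarrow> ?R g * X = X * \<sigma> g"
      using exists_irreducible_constituent[OF is_group R vec_subspace_kernel[of ?Q'] inv ne] by auto
    have srep: "representation G k \<sigma>" and k: "k > 0" using \<sigma> by (auto simp: irreducible_rep_iff)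
    define ks where "ks = [0..<k]"
    have ks: "distinct ks" "set ks = {..<k}" "length ks = k" by (auto simp: ks_def)
    obtain x where Xx: "X = indexed_mat gs ks x"
      using mat_as_indexed_mat[OF gs(1) ks(1)] X(1) ks(3) by metis
    have "?Q' * X = indexed_mat js ks (\<lambda>_ _. 0)"
    proof (rule mat_eq_if_mult_vec_eq[of _ "length js" k])
      fix v :: "complex vec" assume v: "v \<in> carrier_vec k"
      have "(?Q' * X) *\<^sub>v v = ?Q' *\<^sub>v (X *\<^sub>v v)"
        by (rule assoc_mult_mat_vec[OF indexed_mat_carrier X(1) v])
      also have "\<dots> = 0\<^sub>v (length js)" using X(3)[OF v] by simp
      also have "\<dots> = indexed_mat js ks (\<lambda>_ _. 0) *\<^sub>v v"
        using v by (intro eq_vecI) (auto simp: indexed_mat_def scalar_prod_def ks)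
      finally show "(?Q' * X) *\<^sub>v v = indexed_mat js ks (\<lambda>_ _. 0) *\<^sub>v v" .
    qed (use X(1) ks(3) indexed_mat_carrier[of js ks] in auto)
    then have kerX: "(\<Sum>g\<in>carrier G. dual_coef y g * x g b) = 0" if "y \<in> coef_index" "b < k" for y b
      using that unfolding Xx indexed_mat_mult[OF gs(1)] indexed_mat_eq_iff gs(2) js(2) ks(2) by auto
    \<comment> \<open>The row at \<one> of the relation ?R h * X = X * \<sigma> h: all rows of
      \<open>X\<close> are determined by the one at the identity.\<close>
    have transl: "x h b = (\<Sum>c<k. x \<one> c * \<sigma> h $$ (c, b))" if h: "h \<in> carrier G" and b: "b < k" for h b
    proof -
      have "\<sigma> h = indexed_mat ks ks (\<lambda>c b. \<sigma> h $$ (c, b))"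
        using representation_carrier[OF is_group srep h] by (intro eq_matI) (auto simp: indexed_mat_def ks_def)
      then have "?R h * X = X * indexed_mat ks ks (\<lambda>c b. \<sigma> h $$ (c, b))" using X(4)[OF h] by simp
      then have "(\<Sum>c<k. x \<one> c * \<sigma> h $$ (c, b)) = (\<Sum>m\<in>carrier G. of_bool (m = \<one> \<otimes> h) * x m b)"
        using b unfolding Xx indexed_mat_mult[OF gs(1)] indexed_mat_mult[OF ks(1)] indexed_mat_eq_iff gs(2) ks(2)
        by auto
      also have "(\<Sum>m\<in>carrier G. of_bool (m = \<one> \<otimes> h) * x m b) = (\<Sum>m\<in>carrier G. if m = h then x m b else 0)"
        using h by (intro sum.cong refl) auto
      finally show ?thesis using h fin by simp
    qed
    obtain i z where i: "i \<in> {1..\<nu>}" and z: "\<And>h c b. h \<in> carrier G \<Longrightarrow> c < k \<Longrightarrow> b < k \<Longrightarrow>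
        \<sigma> h $$ (c, b) = (\<Sum>a<d i. \<Sum>e<d i. z c a e b * \<rho> i h $$ (a, e))"
      using equivalent_rep_coefs[OF \<sigma>] by blast
    define y where "y b a e = (\<Sum>c<k. x \<one> c * z c a e b)" for b a e
    have xy: "x h b = (\<Sum>a<d i. \<Sum>e<d i. y b a e * coef h (i, a, e))" if h: "h \<in> carrier G" and b: "b < k" for h b
    proof -
      have "x h b = (\<Sum>c<k. \<Sum>a<d i. \<Sum>e<d i. x \<one> c * z c a e b * \<rho> i h $$ (a, e))"
        using transl[OF h b] z[OF h _ b] by (simp add: sum_distrib_left mult.assoc)
      also have "\<dots> = (\<Sum>a<d i. \<Sum>c<k. \<Sum>e<d i. x \<one> c * z c a e b * \<rho> i h $$ (a, e))" by (rule sum.swap)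
      also have "\<dots> = (\<Sum>a<d i. \<Sum>e<d i. \<Sum>c<k. x \<one> c * z c a e b * \<rho> i h $$ (a, e))"
        by (intro sum.cong refl sum.swap)
      finally show ?thesis by (simp add: y_def coef_def sum_distrib_right)
    qed
    \<comment> \<open>Applying the dual coefficient at (i, a, e) to column \<open>b\<close> of
      \<open>X\<close> gives 0 by \<open>kerX\<close>, but isolates \<open>y b a e\<close> by
      orthogonality.\<close>
    have "y b a e = 0" if b: "b < k" and ae: "a < d i" "e < d i" for b a e
    proof -
      have mem: "(i, a', e') \<in> coef_index" if "a' < d i" "e' < d i" for a' e'
        using that i by (simp add: coef_index_def)
      have "0 = (\<Sum>g\<in>carrier G. dual_coef (i, a, e) g * (\<Sum>a'<d i. \<Sum>e'<d i. y b a' e' * coef g (i, a', e')))"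
        using kerX[OF mem[OF ae] b] xy[OF _ b] by simp
      also have "\<dots> = (\<Sum>g\<in>carrier G. \<Sum>a'<d i. \<Sum>e'<d i. y b a' e' * (dual_coef (i, a, e) g * coef g (i, a', e')))"
        by (simp add: sum_distrib_left mult_ac)
      also have "\<dots> = (\<Sum>a'<d i. \<Sum>g\<in>carrier G. \<Sum>e'<d i. y b a' e' * (dual_coef (i, a, e) g * coef g (i, a', e')))"
        by (rule sum.swap)
      also have "\<dots> = (\<Sum>a'<d i. \<Sum>e'<d i. \<Sum>g\<in>carrier G. y b a' e' * (dual_coef (i, a, e) g * coef g (i, a', e')))"
        by (intro sum.cong refl sum.swap)
      also have "\<dots> = (\<Sum>a'<d i. \<Sum>e'<d i. y b a' e' * of_bool ((i, a, e) = (i, a', e')))"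
        by (intro sum.cong refl) (simp add: coef_orthogonal mem ae flip: sum_distrib_left)
      also have "\<dots> = (\<Sum>a'<d i. if a' = a then \<Sum>e'<d i. if e' = e then y b a e else 0 else 0)"
        by (intro sum.cong refl) auto
      also have "\<dots> = y b a e" using ae by simp
      finally show ?thesis by simp
    qed
    then have "x h b = 0" if "h \<in> carrier G" "b < k" for h b
      using xy[OF that] that by simp
    then have "X = indexed_mat gs ks (\<lambda>_ _. 0)"
      unfolding Xx indexed_mat_eq_iff gs(2) ks(2) by simp
    \<comment> \<open>A zero matrix with \<open>k > 0\<close> columns is not injective.\<close>
    then have "X *\<^sub>v unit_vec k 0 = 0\<^sub>v ?n"
      by (intro eq_vecI) (auto simp: indexed_mat_def scalar_prod_def ks)
    then have "unit_vec k 0 = (0\<^sub>v k :: complex vec)" using inj_matD[OF X(2,1)] by simp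
    from arg_cong[OF this, of "\<lambda>v. v $ 0"] show False using k by simp
  qed
  then show ?thesis unfolding inj_mat_def by auto
qed

text \<open>From Q' Q = 1 follows Q' (Q Q') = Q', and injectivity of Q' cancels it to Q Q' = 1. The
  two-sided inverse then forces both index sets to have the same size.\<close>

lemma coef_complete_and_card:
  "(\<forall>g\<in>carrier G. \<forall>h\<in>carrier G. (\<Sum>x\<in>coef_index. coef g x * dual_coef x h) = of_bool (g = h)) \<and>
   card coef_index = card (carrier G)"
proof -
  obtain gs where gs: "set gs = carrier G" "distinct gs" using finite_distinct_list[OF fin] by blast
  obtain js where js: "set js = coef_index" "distinct js"
    using finite_distinct_list[OF finite_coef_index] by blast
  let ?Q = "indexed_mat gs js coef" and ?Q' = "indexed_mat js gs dual_coef"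
  have 1: "?Q' * ?Q = 1\<^sub>m (length js)"
    unfolding indexed_mat_mult[OF gs(2)] indexed_mat_one[OF js(2), symmetric] indexed_mat_eq_iff gs(1) js(1)
    using coef_orthogonal by auto
  have "?Q' * (?Q * ?Q') = ?Q' * ?Q * ?Q'"
    by (rule assoc_mult_mat[symmetric]) (rule indexed_mat_carrier)+
  also have "\<dots> = ?Q' * 1\<^sub>m (length gs)"
    unfolding 1 by (metis indexed_mat_carrier left_mult_one_mat right_mult_one_mat)
  finally have 2: "?Q * ?Q' = 1\<^sub>m (length gs)"
    by (rule inj_mat_cancel_left[OF dual_coef_inj[OF gs(2,1) js(2,1)] indexed_mat_carrier
        mult_carrier_mat[OF indexed_mat_carrier indexed_mat_carrier] one_carrier_mat])
  then have "\<forall>g\<in>carrier G. \<forall>h\<in>carrier G. (\<Sum>x\<in>coef_index. coef g x * dual_coef x h) = of_bool (g = h)"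
    unfolding indexed_mat_mult[OF js(2)] indexed_mat_one[OF gs(2), symmetric] indexed_mat_eq_iff gs(1) js(1) .
  moreover have "length gs = length js" by (rule inverse_mats_same_dim[OF 2 1]) auto
  ultimately show ?thesis using gs js distinct_card by metis
qed

lemmas coef_complete = coef_complete_and_card[THEN conjunct1, rule_format]

lemma sum_dims_squared: "(\<Sum>i\<in>{1..\<nu>}. (d i)\<^sup>2) = card (carrier G)"
  using coef_complete_and_card[THEN conjunct2] by (simp add: coef_index_def power2_eq_square)

end

section \<open>The spectrum of a lift\<close>

text \<open>A lifted arc is determined by its base arc and the group component of its tail, which is
  fixed here.\<close>

lemma card_arcs_lift:
  assumes "g \<in> carrier G"
  shows "card (arcs_from_to (lift_digraph \<Gamma> G \<alpha>) (u, g) (v, h)) =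
    card {e \<in> arcs_from_to \<Gamma> u v. g \<otimes>\<^bsub>G\<^esub> \<alpha> e = h}"
proof -
  have "arcs_from_to (lift_digraph \<Gamma> G \<alpha>) (u, g) (v, h) =
      (\<lambda>e. (e, g)) ` {e \<in> arcs_from_to \<Gamma> u v. g \<otimes>\<^bsub>G\<^esub> \<alpha> e = h}"
    using assms by (auto simp: arcs_from_to_def lift_digraph_def)
  then show ?thesis by (simp add: card_image inj_on_def)
qed

lemma distinct_concat_map:
  assumes "distinct bs" and "\<And>b. b \<in> set bs \<Longrightarrow> distinct (f b)"
    and "\<And>b c. b \<in> set bs \<Longrightarrow> c \<in> set bs \<Longrightarrow> b \<noteq> c \<Longrightarrow> set (f b) \<inter> set (f c) = {}"
  shows "distinct (concat (map f bs))"
  using assms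
proof (induction bs)
  case (Cons a bs)
  have "distinct (concat (map f bs))"
    by (rule Cons.IH) (use Cons.prems(1) in simp, (rule Cons.prems(2-3); simp)+)
  moreover have "set (f a) \<inter> set (f b) = {}" if "b \<in> set bs" for b
    using Cons.prems(1) Cons.prems(3)[of a b] that by auto
  ultimately show ?case using Cons.prems(2)[of a] by auto
qed simp

lemma char_poly_nonzero: "(A :: complex mat) \<in> carrier_mat n n \<Longrightarrow> char_poly A \<noteq> 0"
  using degree_monic_char_poly[of A n] by auto

lemma size_spec: "A \<in> carrier_mat n n \<Longrightarrow> size (spec A) = n"
  using degree_monic_char_poly[of A n] by (simp add: spec_def size_proots_complex)

lemma rep_mat_associated_carrier:
  "rep_mat G d \<rho> (associated_mat \<Gamma> \<alpha> vs) \<in> carrier_mat (length vs * d) (length vs * d)"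
  by (simp add: rep_mat_def associated_mat_def)

section \<open>Block diagonalization of the adjacency matrix of the lift\<close>

context finite_group_irreps
begin

context
  fixes \<Gamma> :: "('v, 'e) pre_digraph" and \<alpha> :: "'e \<Rightarrow> 'a"
  assumes fin_arcs: "finite (arcs \<Gamma>)" and \<alpha>: "\<alpha> \<in> arcs \<Gamma> \<rightarrow> carrier G"
begin

lemma finite_arcs_from_to: "finite (arcs_from_to \<Gamma> u v)"
  using fin_arcs by (simp add: arcs_from_to_def)

lemma voltage_closed: "e \<in> arcs_from_to \<Gamma> u v \<Longrightarrow> \<alpha> e \<in> carrier G"
  using \<alpha> by (auto simp: arcs_from_to_def)

text \<open>The entry of the associated matrix, addressed by vertices instead of list
  positions.\<close>

definition arc_sum :: "'v \<Rightarrow> 'v \<Rightarrow> 'a \<Rightarrow> complex" where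
  "arc_sum u v = (\<lambda>g. \<Sum>e\<in>arcs_from_to \<Gamma> u v. of_bool (\<alpha> e = g))"

lemma group_algebra_rep_arc_sum:
  assumes "c < d i" "b < d i"
  shows "group_algebra_rep G (d i) (\<rho> i) (arc_sum u v) $$ (c, b)
    = (\<Sum>e\<in>arcs_from_to \<Gamma> u v. \<rho> i (\<alpha> e) $$ (c, b))"
proof -
  have "group_algebra_rep G (d i) (\<rho> i) (arc_sum u v) $$ (c, b)
      = (\<Sum>g\<in>carrier G. \<Sum>e\<in>arcs_from_to \<Gamma> u v. of_bool (\<alpha> e = g) * \<rho> i g $$ (c, b))"
    using assms by (simp add: group_algebra_rep_def arc_sum_def sum_distrib_right)
  also have "\<dots> = (\<Sum>e\<in>arcs_from_to \<Gamma> u v. \<Sum>g\<in>carrier G. of_bool (\<alpha> e = g) * \<rho> i g $$ (c, b))"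
    by (rule sum.swap)
  also have "\<dots> = (\<Sum>e\<in>arcs_from_to \<Gamma> u v. \<Sum>g\<in>carrier G. if g = \<alpha> e then \<rho> i g $$ (c, b) else 0)"
    by (intro sum.cong refl) auto
  also have "\<dots> = (\<Sum>e\<in>arcs_from_to \<Gamma> u v. \<rho> i (\<alpha> e) $$ (c, b))"
    using fin voltage_closed by (intro sum.cong refl) simp
  finally show ?thesis .
qed

text \<open>The block diagonal target matrix. The label (i, a) must agree in row and column, while
  the value does not depend on \<open>a\<close>; this produces \<open>d i\<close> equal blocks for
  each \<open>i\<close>.\<close>

definition block_entry :: "'v \<times> nat \<times> nat \<times> nat \<Rightarrow> 'v \<times> nat \<times> nat \<times> nat \<Rightarrow> complex" where
  "block_entry = (\<lambda>(u, i, a, c) (v, j, a', b). of_bool (i = j \<and> a = a') *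
     group_algebra_rep G (d i) (\<rho> i) (arc_sum u v) $$ (c, b))"

text \<open>The heart of the diagonalization: each arc e contributes the coefficient at g \<otimes>
  \<alpha> e, and multiplicativity of \<open>\<rho> i\<close> separates the dependence on
  \<open>g\<close> from that on the voltages.\<close>

lemma lift_sum_adjacency_coef:
  assumes g: "g \<in> carrier G" and i: "i \<in> {1..\<nu>}" "a < d i" "b < d i"
  shows "(\<Sum>h\<in>carrier G. of_nat (card (arcs_from_to (lift_digraph \<Gamma> G \<alpha>) (u, g) (v, h))) * \<rho> i h $$ (a, b))
    = (\<Sum>c<d i. \<rho> i g $$ (a, c) * group_algebra_rep G (d i) (\<rho> i) (arc_sum u v) $$ (c, b))"
proof -
  let ?E = "arcs_from_to \<Gamma> u v"
  have "of_nat (card (arcs_from_to (lift_digraph \<Gamma> G \<alpha>) (u, g) (v, h))) =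
      (\<Sum>e\<in>?E. of_bool (g \<otimes> \<alpha> e = h) :: complex)" for h
    using finite_arcs_from_to by (simp add: card_arcs_lift[OF g] Int_def)
  then have "(\<Sum>h\<in>carrier G. of_nat (card (arcs_from_to (lift_digraph \<Gamma> G \<alpha>) (u, g) (v, h))) * \<rho> i h $$ (a, b))
      = (\<Sum>h\<in>carrier G. \<Sum>e\<in>?E. of_bool (g \<otimes> \<alpha> e = h) * \<rho> i h $$ (a, b))"
    by (simp add: sum_distrib_right)
  also have "\<dots> = (\<Sum>e\<in>?E. \<Sum>h\<in>carrier G. of_bool (g \<otimes> \<alpha> e = h) * \<rho> i h $$ (a, b))"
    by (rule sum.swap)
  also have "\<dots> = (\<Sum>e\<in>?E. \<Sum>h\<in>carrier G. if h = g \<otimes> \<alpha> e then \<rho> i h $$ (a, b) else 0)"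
    by (intro sum.cong refl) auto
  also have "\<dots> = (\<Sum>e\<in>?E. \<rho> i (g \<otimes> \<alpha> e) $$ (a, b))"
    using fin voltage_closed g by (intro sum.cong refl) simp
  also have "\<dots> = (\<Sum>e\<in>?E. \<Sum>c<d i. \<rho> i g $$ (a, c) * \<rho> i (\<alpha> e) $$ (c, b))"
    using voltage_closed g i by (intro sum.cong refl representation_mult_entry[OF is_group rep]) auto
  also have "\<dots> = (\<Sum>c<d i. \<Sum>e\<in>?E. \<rho> i g $$ (a, c) * \<rho> i (\<alpha> e) $$ (c, b))"
    by (rule sum.swap)
  finally show ?thesis using i by (simp add: group_algebra_rep_arc_sum sum_distrib_left)
qed

text \<open>\<open>List.product\<close> puts the pair of vertex number p div d i and entry p mod d i
  at position p, which is exactly the block layout of \<open>rep_mat\<close>.\<close>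

lemma indexed_block:
  defines "js \<equiv> \<lambda>i a vs. map (\<lambda>(u, c). (u, i, a, c)) (List.product vs [0..<d i])"
  shows "indexed_mat (js i a vs) (js i a vs) block_entry = rep_mat G (d i) (\<rho> i) (associated_mat \<Gamma> \<alpha> vs)"
proof (rule eq_matI)
  fix p q assume "p < dim_row (rep_mat G (d i) (\<rho> i) (associated_mat \<Gamma> \<alpha> vs))"
    "q < dim_col (rep_mat G (d i) (\<rho> i) (associated_mat \<Gamma> \<alpha> vs))"
  then have p: "p < length vs * d i" and q: "q < length vs * d i"
    by (simp_all add: rep_mat_def associated_mat_def)
  have nth_js: "js i a vs ! p' = (vs ! (p' div d i), i, a, p' mod d i)" if "p' < length vs * d i" for p'
  proof -
    have "d i > 0" using that by (cases "d i") auto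
    then show ?thesis using that by (simp add: js_def product_nth)
  qed
  have "length (js i a vs) = length vs * d i" by (simp add: js_def)
  moreover have "p div d i < length vs" "q div d i < length vs"
    using p q by (simp_all add: less_mult_imp_div_less)
  ultimately show "indexed_mat (js i a vs) (js i a vs) block_entry $$ (p, q) =
      rep_mat G (d i) (\<rho> i) (associated_mat \<Gamma> \<alpha> vs) $$ (p, q)"
    using p q by (simp add: rep_mat_def associated_mat_def indexed_mat_def nth_js block_entry_def arc_sum_def)
qed (simp_all add: rep_mat_def associated_mat_def js_def)

theorem char_poly_lift:
  assumes vs: "distinct vs" "set vs = verts \<Gamma>"
    and xs: "distinct xs" "set xs = verts (lift_digraph \<Gamma> G \<alpha>)"
  shows "char_poly (adjacency_mat (lift_digraph \<Gamma> G \<alpha>) xs) =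
    (\<Prod>i\<in>{1..\<nu>}. char_poly (rep_mat G (d i) (\<rho> i) (associated_mat \<Gamma> \<alpha> vs)) ^ d i)"
proof -
  let ?I = "SIGMA i:{1..\<nu>}. {..<d i}"
  obtain bs where bs: "set bs = ?I" "distinct bs"
    using finite_distinct_list[of ?I] by auto
  \<comment> \<open>Each label (i, a) gets the list of indices of one block; concatenation over all
    labels enumerates the columns of the base change matrix.\<close>
  define f :: "nat \<times> nat \<Rightarrow> ('v \<times> nat \<times> nat \<times> nat) list" where
    "f = (\<lambda>(i, a). map (\<lambda>(u, c). (u, i, a, c)) (List.product vs [0..<d i]))"
  define js where "js = concat (map f bs)"
  have finV: "finite (verts \<Gamma>)" using vs(2) by (metis List.finite_set)
  have setf: "set (f b) = {(u, i, a, c). u \<in> verts \<Gamma> \<and> b = (i, a) \<and> c < d i}" for b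
    using vs(2) by (cases b) (auto simp: f_def image_iff)
  have set_js: "set js = verts \<Gamma> \<times> coef_index"
    by (auto simp: js_def setf bs coef_index_def)
  have "distinct js"
    unfolding js_def
    by (rule distinct_concat_map[OF bs(2)])
       (auto simp: setf f_def distinct_map inj_on_def distinct_product vs(1))
  have set_xs: "set xs = verts \<Gamma> \<times> carrier G" using xs(2) by (simp add: lift_digraph_def)
  have sum_xs: "(\<Sum>x\<in>set xs. F x) = (\<Sum>u\<in>verts \<Gamma>. \<Sum>g\<in>carrier G. F (u, g))" for F :: "_ \<Rightarrow> complex"
    by (simp add: set_xs sum.cartesian_product)
  have sum_js: "(\<Sum>y\<in>set js. F y) = (\<Sum>u\<in>verts \<Gamma>. \<Sum>x\<in>coef_index. F (u, x))" for F :: "_ \<Rightarrow> complex"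
    by (simp add: set_js sum.cartesian_product)
  \<comment> \<open>Removes the identity factor acting on the vertices.\<close>
  have collapse: "(\<Sum>v\<in>verts \<Gamma>. \<Sum>x\<in>X. of_bool (u = v) * F v x) = (\<Sum>x\<in>X. F u x)"
    if "u \<in> verts \<Gamma>" for u X and F :: "'v \<Rightarrow> 'z \<Rightarrow> complex"
  proof -
    have "(\<Sum>v\<in>verts \<Gamma>. \<Sum>x\<in>X. of_bool (u = v) * F v x) = (\<Sum>v\<in>verts \<Gamma>. if v = u then \<Sum>x\<in>X. F v x else 0)"
      by (intro sum.cong refl) auto
    then show ?thesis using finV that by simp
  qed
  \<comment> \<open>\<open>?P\<close> is 1 \<otimes> Q and \<open>?P'\<close> is 1 \<otimes> Q',
    written entrywise.\<close>
  let ?P = "\<lambda>(u, g) (v, x). of_bool (u = v) * coef g x"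
  let ?P' = "\<lambda>(v, x) (u, g). of_bool (v = u) * dual_coef x g"
  let ?A = "\<lambda>x y. of_nat (card (arcs_from_to (lift_digraph \<Gamma> G \<alpha>) x y)) :: complex"
  have PP': "(\<Sum>y\<in>set js. ?P x y * ?P' y z) = of_bool (x = z)" if "x \<in> set xs" "z \<in> set xs" for x z
  proof -
    obtain u g w h where e: "x = (u, g)" "z = (w, h)" by (cases x, cases z)
    have m: "u \<in> verts \<Gamma>" "g \<in> carrier G" "h \<in> carrier G" using that by (auto simp: e set_xs)
    have "(\<Sum>y\<in>set js. ?P x y * ?P' y z) =
        (\<Sum>v\<in>verts \<Gamma>. \<Sum>y\<in>coef_index. of_bool (u = v) * (of_bool (v = w) * (coef g y * dual_coef y h)))"
      by (simp add: sum_js e mult_ac)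
    also have "\<dots> = of_bool (u = w) * (\<Sum>y\<in>coef_index. coef g y * dual_coef y h)"
      unfolding collapse[OF m(1)] by (simp add: sum_distrib_left)
    finally show ?thesis by (simp add: coef_complete m e)
  qed
  have P'P: "(\<Sum>x\<in>set xs. ?P' y x * ?P x w) = of_bool (y = w)" if "y \<in> set js" "w \<in> set js" for y w
  proof -
    obtain u p v q where e: "y = (u, p)" "w = (v, q)" by (cases y, cases w)
    have m: "u \<in> verts \<Gamma>" "p \<in> coef_index" "q \<in> coef_index" using that by (auto simp: e set_js)
    have "(\<Sum>x\<in>set xs. ?P' y x * ?P x w) =
        (\<Sum>x\<in>verts \<Gamma>. \<Sum>g\<in>carrier G. of_bool (u = x) * (of_bool (x = v) * (dual_coef p g * coef g q)))"
      by (simp add: sum_xs e mult_ac)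
    also have "\<dots> = of_bool (u = v) * (\<Sum>g\<in>carrier G. dual_coef p g * coef g q)"
      unfolding collapse[OF m(1)] by (simp add: sum_distrib_left)
    finally show ?thesis by (simp add: coef_orthogonal m e)
  qed
  have AP: "(\<Sum>z\<in>set xs. ?A x z * ?P z y) = (\<Sum>w\<in>set js. ?P x w * block_entry w y)"
    if "x \<in> set xs" "y \<in> set js" for x y
  proof -
    obtain u g where x: "x = (u, g)" by (cases x)
    obtain w i a b where y: "y = (w, i, a, b)" by (cases y)
    have m: "u \<in> verts \<Gamma>" "g \<in> carrier G" "w \<in> verts \<Gamma>" "i \<in> {1..\<nu>}" "a < d i" "b < d i"
      using that by (auto simp: x y set_xs set_js coef_index_def)
    have "(\<Sum>z\<in>set xs. ?A x z * ?P z y) =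
        (\<Sum>v\<in>verts \<Gamma>. \<Sum>h\<in>carrier G. of_bool (w = v) * (?A (u, g) (v, h) * \<rho> i h $$ (a, b)))"
      unfolding sum_xs by (intro sum.cong refl) (auto simp: x y coef_def)
    also have "\<dots> = (\<Sum>h\<in>carrier G. ?A (u, g) (w, h) * \<rho> i h $$ (a, b))"
      by (rule collapse[OF m(3)])
    also have "\<dots> = (\<Sum>c<d i. \<rho> i g $$ (a, c) * group_algebra_rep G (d i) (\<rho> i) (arc_sum u w) $$ (c, b))"
      by (rule lift_sum_adjacency_coef[OF m(2,4,5,6)])
    also have "\<dots> = (\<Sum>z\<in>coef_index. case z of (j, a', c) \<Rightarrow> of_bool (i = j \<and> a = a') *
        (\<rho> j g $$ (a', c) * group_algebra_rep G (d j) (\<rho> j) (arc_sum u w) $$ (c, b)))"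
      by (rule sum_coef_row[OF m(4,5), symmetric])
    also have "\<dots> = (\<Sum>z\<in>coef_index. coef g z * block_entry (u, z) y)"
      by (intro sum.cong refl) (auto simp: coef_def block_entry_def y)
    also have "\<dots> = (\<Sum>v\<in>verts \<Gamma>. \<Sum>z\<in>coef_index. of_bool (u = v) * (coef g z * block_entry (v, z) y))"
      by (rule collapse[OF m(1), symmetric])
    also have "\<dots> = (\<Sum>w\<in>set js. ?P x w * block_entry w y)"
      unfolding sum_js by (intro sum.cong refl) (auto simp: x)
    finally show ?thesis .
  qed
  have "adjacency_mat (lift_digraph \<Gamma> G \<alpha>) xs = indexed_mat xs xs ?A"
    by (simp add: adjacency_mat_def indexed_mat_def)
  then have "char_poly (adjacency_mat (lift_digraph \<Gamma> G \<alpha>) xs) = char_poly (indexed_mat js js block_entry)"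
    using indexed_mat_similar(2)[OF xs(1) \<open>distinct js\<close> PP' P'P AP] by simp
  also have "\<dots> = (\<Prod>b\<in>set bs. char_poly (indexed_mat (f b) (f b) block_entry))"
    unfolding js_def by (rule char_poly_indexed_mat_concat[OF bs(2)]) (auto simp: setf block_entry_def)
  also have "\<dots> = (\<Prod>(i, a)\<in>?I. char_poly (rep_mat G (d i) (\<rho> i) (associated_mat \<Gamma> \<alpha> vs)))"
    unfolding bs(1) by (intro prod.cong refl) (auto simp: f_def indexed_block)
  \<comment> \<open>The factors do not depend on \<open>a\<close>, so the inner product is a power
    with exponent \<open>d i\<close>.\<close>
  also have "\<dots> = (\<Prod>i\<in>{1..\<nu>}. \<Prod>a<d i. char_poly (rep_mat G (d i) (\<rho> i) (associated_mat \<Gamma> \<alpha> vs)))"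
    by (rule prod.Sigma[symmetric]) auto
  finally show ?thesis by simp
qed

end

end

theorem theorem1:
  fixes \<Gamma> :: "('v, 'e) pre_digraph"
    and G :: "('g, 'm) monoid_scheme"
    and \<alpha> :: "'e \<Rightarrow> 'g"
    and \<nu> r n :: nat
    and d :: "nat \<Rightarrow> nat"
    and \<rho> :: "nat \<Rightarrow> 'g \<Rightarrow> complex mat"
    and vs :: "'v list"
    and xs :: "('v \<times> 'g) list"
  assumes "fin_digraph \<Gamma>" and "card (verts \<Gamma>) = r"
    and "group G" and "finite (carrier G)" and "Coset.order G = n"
    and "\<alpha> \<in> arcs \<Gamma> \<rightarrow> carrier G"
    and "card (conjugacy_classes G) = \<nu>"
    and "irreducible_reps_of G \<nu> d \<rho>"
    and "distinct vs" and "set vs = verts \<Gamma>"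
    and "distinct xs" and "set xs = verts (lift_digraph \<Gamma> G \<alpha>)"
  shows "(\<Sum>i\<in>{1..\<nu>}. (d i)\<^sup>2) = n \<and>
    size (spec (adjacency_mat (lift_digraph \<Gamma> G \<alpha>) xs)) = r * n \<and>
    (\<forall>i\<in>{1..\<nu>}. size (spec (rep_mat G (d i) (\<rho> i) (associated_mat \<Gamma> \<alpha> vs))) = r * d i) \<and>
    spec (adjacency_mat (lift_digraph \<Gamma> G \<alpha>) xs) =
      (\<Sum>i\<in>{1..\<nu>}. repeat_mset (d i) (spec (rep_mat G (d i) (\<rho> i) (associated_mat \<Gamma> \<alpha> vs))))"
proof -
  interpret group G by fact
  interpret finite_group_irreps G \<nu> d \<rho>
    by unfold_locales (use assms in auto)
  have n: "card (carrier G) = n" using assms(5) by (simp add: Coset.order_def)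
  have r: "length vs = r" using assms(2,9,10) distinct_card by metis
  have fin_arcs: "finite (arcs \<Gamma>)" using assms(1) by (rule fin_digraph.finite_arcs)
  have "length xs = card (verts \<Gamma> \<times> carrier G)"
    using distinct_card[OF assms(11)] assms(12) by (simp add: lift_digraph_def)
  then have xs: "length xs = r * n" by (simp add: card_cartesian_product assms(2) n)
  have "size (spec (adjacency_mat (lift_digraph \<Gamma> G \<alpha>) xs)) = r * n"
    by (rule size_spec) (simp add: adjacency_mat_def xs)
  moreover have "size (spec (rep_mat G (d i) (\<rho> i) (associated_mat \<Gamma> \<alpha> vs))) = r * d i" for i
    using size_spec[OF rep_mat_associated_carrier] r by blast
  \<comment> \<open>For nonzero polynomials the multiset of roots turns products into sums and
    powers into repetitions, which translates the factorization into the claim on spectra.\<close>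
  moreover have nz: "char_poly (rep_mat G (d i) (\<rho> i) (associated_mat \<Gamma> \<alpha> vs)) \<noteq> 0" for i
    by (rule char_poly_nonzero[OF rep_mat_associated_carrier])
  moreover have "spec (adjacency_mat (lift_digraph \<Gamma> G \<alpha>) xs) =
      (\<Sum>i\<in>{1..\<nu>}. repeat_mset (d i) (spec (rep_mat G (d i) (\<rho> i) (associated_mat \<Gamma> \<alpha> vs))))"
    unfolding spec_def char_poly_lift[OF fin_arcs assms(6,9-12)]
    using nz by (subst proots_prod) (auto simp: proots_power)
  ultimately show ?thesis using sum_dims_squared n by simp
qed

end
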